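(* Suppose SJA for $m$ items is well-defined. If for every $J\subseteq[m]$ with $U_J\neq\emptyset$ the SIM-body $\Lambda(\lambda_1,\dots,\lambda_{|J|})$ contains no body of positive $1$-deficiency, then SJA is optimal: its expected revenue equals the supremum of expected revenue over all (possibly randomized) IC and IR mechanisms for a single additive buyer with i.i.d. uniform $[0,1]$ values for the $m$ items.
   Context: Mechanisms: allocation $\mathbf a:[0,1]^m\to[0,1]^m$ and payment $p:[0,1]^m\to\mathbb R$; buyer utility for report $\mathbf x'$ and true values $\mathbf x$ is $\mathbf a(\mathbf x')\cdot\mathbf x-p(\mathbf x')$; IC means truthful reporting maximizes utility, IR means truthful utility $\ge 0$; revenue is $\mathbb E[p(\mathbf x)]$. SJA: let $k=1/(m+1)$, $p_0=0$. SJA is the deterministic mechanism selling any bundle of $r$ items at price $p_r$, the buyer taking a bundle maximizing $\sum_{j\in J}x_j-p_{|J|}$. Prices are fixed successively: having fixed $p_1,\dots,p_{r-1}$, $p_r$ is chosen as large as possible with $\Pr_{\mathbf x\sim U[0,1]^r}[\sum_{j\in J}x_j<p_{|J|}\ \forall J\subseteq[r]]=1-rk$; SJA is well-defined if such prices exist. Normalize: for every $j\in[m-1]$ with $p_j\ge p_m$ replace $p_j$ by $p_m$. With normalized prices, $\mu_0=0$, $\mu_r=(m+1)(r-p_r)$, $\lambda_r=\mu_r-\mu_{r-1}$. $U_J=\{\mathbf x\in[0,1]^m:\sum_{j\in J}x_j-p_{|J|}\ge\sum_{j\in L}x_j-p_{|L|}\ \forall L\subseteq[m]\}$. SIM-body: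 for $0<\alpha_1\le\dots\le\alpha_r$, $\Lambda(\alpha_1,\dots,\alpha_r)=\{\mathbf x\in\mathbb R_+^r:\sum_{j\in J}x_j\le\sum_{j=r-|J|+1}^r\alpha_j\ \forall J\subseteq[r]\}$. A body is a compact subset of $\mathbb R_+^r$; its $k$-deficiency is $\delta_k(A)=|A|-k\sum_{j=1}^r|A_{[r]\setminus\{j\}}|$, with $A_{[r]\setminus\{j\}}=\{\mathbf x_{-j}:\mathbf x\in A\}$ and $|\cdot|$ Lebesgue measure in the relevant dimension. *)

theory Defs
  imports "HOL-Analysis.Analysis"
begin

(* Items are indexed by {..<m}; a value profile is an extensional function nat => real. *)

definition cube :: "nat \<Rightarrow> (nat \<Rightarrow> real) set" where
  "cube m = PiE {..<m} (\<lambda>_. {0..1})"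

definition unifM :: "nat \<Rightarrow> (nat \<Rightarrow> real) measure" where
  "unifM r = PiM {..<r} (\<lambda>_. restrict_space lborel {0..1::real})"

definition dotp :: "nat \<Rightarrow> (nat \<Rightarrow> real) \<Rightarrow> (nat \<Rightarrow> real) \<Rightarrow> real" where
  "dotp m y x = (\<Sum>i<m. y i * x i)"

definition is_alloc :: "nat \<Rightarrow> ((nat \<Rightarrow> real) \<Rightarrow> (nat \<Rightarrow> real)) \<Rightarrow> bool" where
  "is_alloc m a \<longleftrightarrow> (\<forall>x\<in>cube m. \<forall>i<m. 0 \<le> a x i \<and> a x i \<le> 1)"

definition is_IC :: "nat \<Rightarrow> ((nat \<Rightarrow> real) \<Rightarrow> (nat \<Rightarrow> real)) \<Rightarrow> ((nat \<Rightarrow> real) \<Rightarrow> real) \<Rightarrow> bool" where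
  "is_IC m a p \<longleftrightarrow> (\<forall>x\<in>cube m. \<forall>x'\<in>cube m. dotp m (a x') x - p x' \<le> dotp m (a x) x - p x)"

definition is_IR :: "nat \<Rightarrow> ((nat \<Rightarrow> real) \<Rightarrow> (nat \<Rightarrow> real)) \<Rightarrow> ((nat \<Rightarrow> real) \<Rightarrow> real) \<Rightarrow> bool" where
  "is_IR m a p \<longleftrightarrow> (\<forall>x\<in>cube m. 0 \<le> dotp m (a x) x - p x)"

definition revenue :: "nat \<Rightarrow> ((nat \<Rightarrow> real) \<Rightarrow> real) \<Rightarrow> real" where
  "revenue m p = integral\<^sup>L (completion (unifM m)) p"

definition opt_revenue :: "nat \<Rightarrow> real" where
  "opt_revenue m = Sup {revenue m p | a p. is_alloc m a \<and> is_IC m a p \<and> is_IR m a p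
       \<and> p \<in> borel_measurable (completion (unifM m))}"

definition sja_prob :: "nat \<Rightarrow> (nat \<Rightarrow> real) \<Rightarrow> real" where
  "sja_prob r q = measure (unifM r)
     {x \<in> space (unifM r). \<forall>J. J \<subseteq> {..<r} \<and> J \<noteq> {} \<longrightarrow> (\<Sum>j\<in>J. x j) < q (card J)}"

definition sja_prices :: "nat \<Rightarrow> (nat \<Rightarrow> real) \<Rightarrow> bool" where
  "sja_prices m p \<longleftrightarrow> p 0 = 0 \<and>
     (\<forall>r\<in>{1..m}. sja_prob r p = 1 - real r / (real m + 1) \<and>
        (\<forall>c. sja_prob r (p(r := c)) = 1 - real r / (real m + 1) \<longrightarrow> c \<le> p r))"

definition norm_prices :: "nat \<Rightarrow> (nat \<Rightarrow> real) \<Rightarrow> nat \<Rightarrow> real" where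
  "norm_prices m p j = (if 1 \<le> j \<and> j < m \<and> p m \<le> p j then p m else p j)"

definition sja_mu :: "nat \<Rightarrow> (nat \<Rightarrow> real) \<Rightarrow> nat \<Rightarrow> real" where
  "sja_mu m p r = (if r = 0 then 0 else (real m + 1) * (real r - norm_prices m p r))"

definition sja_lambda :: "nat \<Rightarrow> (nat \<Rightarrow> real) \<Rightarrow> nat \<Rightarrow> real" where
  "sja_lambda m p r = sja_mu m p r - sja_mu m p (r - 1)"

definition sja_region :: "nat \<Rightarrow> (nat \<Rightarrow> real) \<Rightarrow> nat set \<Rightarrow> (nat \<Rightarrow> real) set" where
  "sja_region m p J = {x \<in> cube m. \<forall>L. L \<subseteq> {..<m} \<longrightarrow>
      (\<Sum>j\<in>L. x j) - norm_prices m p (card L) \<le> (\<Sum>j\<in>J. x j) - norm_prices m p (card J)}"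

(* SIM-body Lambda(alpha_1,...,alpha_r), coordinates indexed by {..<r}, alpha indexed 1..r *)
definition SIM_body :: "nat \<Rightarrow> (nat \<Rightarrow> real) \<Rightarrow> (nat \<Rightarrow> real) set" where
  "SIM_body r \<alpha> = {x \<in> PiE {..<r} (\<lambda>_. {0..}). \<forall>J. J \<subseteq> {..<r} \<longrightarrow>
      (\<Sum>j\<in>J. x j) \<le> (\<Sum>j\<in>{r - card J + 1..r}. \<alpha> j)}"

definition body :: "nat \<Rightarrow> (nat \<Rightarrow> real) set \<Rightarrow> bool" where
  "body r A \<longleftrightarrow> compact A \<and> A \<subseteq> PiE {..<r} (\<lambda>_. {0..})"

definition deficiency :: "real \<Rightarrow> nat \<Rightarrow> (nat \<Rightarrow> real) set \<Rightarrow> real" where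
  "deficiency k r A = measure (PiM {..<r} (\<lambda>_. lborel)) A
     - k * (\<Sum>j<r. measure (PiM ({..<r} - {j}) (\<lambda>_. lborel))
                         ((\<lambda>x. restrict x ({..<r} - {j})) ` A))"

(* (a,pay) is the SJA mechanism with prices p (any tie-breaking) *)
definition sja_implements :: "nat \<Rightarrow> (nat \<Rightarrow> real) \<Rightarrow> ((nat \<Rightarrow> real) \<Rightarrow> (nat \<Rightarrow> real))
    \<Rightarrow> ((nat \<Rightarrow> real) \<Rightarrow> real) \<Rightarrow> bool" where
  "sja_implements m p a pay \<longleftrightarrow> (\<forall>x\<in>cube m. \<exists>J. J \<subseteq> {..<m} \<and>
      (\<forall>L. L \<subseteq> {..<m} \<longrightarrow> (\<Sum>j\<in>L. x j) - p (card L) \<le> (\<Sum>j\<in>J. x j) - p (card J)) \<and>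
      (\<forall>i<m. a x i = (if i \<in> J then 1 else 0)) \<and> pay x = p (card J))"

end

theory Submission
  imports Defs "HOL-Probability.Infinite_Product_Measure"
begin

text \<open>
  Let \<open>U\<close> be the indirect utility of an IC mechanism, a Lipschitz function on the whole space. The
  allocation is a subgradient of \<open>U\<close>, so comparing \<open>\<integral> U\<close> with the integral of \<open>U\<close> after
  rescaling one coordinate shows that the revenue is \<open>\<Sum>\<^sub>j \<integral> U(1, x\<^sub>-\<^sub>j) - (m + 1) \<integral> U\<close>, a
  functional linear in \<open>U\<close>. With \<open>w\<close> the utility under SJA minus the utility under a rival
  mechanism, it has to be shown that \<open>(m + 1) \<integral> w\<close> is at most the sum of the integrals of \<open>w\<close>
  over the faces \<open>x\<^sub>j = 1\<close>.

  Where the bundle \<open>J\<close> is demanded, the SJA utility has slope 1 in the directions \<open>j \<in> J\<close>,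
  whereas the rival utility has slope at most 1, so \<open>w\<close> is nondecreasing there. Hence on every
  section of this region in the coordinates \<open>J\<close> the superlevel sets of \<open>w\<close> are closed under
  raising a coordinate to 1, and the map \<open>y = (m + 1)(1 - x)\<close> turns them into bodies inside the
  SIM-body whose projections are their faces. Nonpositive deficiency of these bodies, integrated
  over all levels and sections, gives the claimed inequality on the region for \<open>w + C \<ge> 0\<close>. The
  constant \<open>C\<close> drops out because the set on which nothing is sold has measure exactly
  \<open>1 / (m + 1)\<close>, and \<open>w \<le> 0\<close> there.
\<close>

section \<open>Continuity and compactness in function spaces\<close>

lemma continuous_on_fun_upd [continuous_intros]:
  fixes f :: "'a::topological_space \<Rightarrow> 'i \<Rightarrow> 'b::topological_space"
  assumes "continuous_on S f" "continuous_on S g"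
  shows "continuous_on S (\<lambda>t. (f t)(i := g t))"
proof (rule continuous_on_coordinatewise_then_product)
  fix k show "continuous_on S (\<lambda>t. ((f t)(i := g t)) k)"
    using assms by (cases "k = i") (auto intro: continuous_on_product_then_coordinatewise)
qed

lemma continuous_on_merge:
  fixes z :: "'i \<Rightarrow> 'b::topological_space"
  shows "continuous_on S (\<lambda>x. merge I J (z, x))"
proof (rule continuous_on_coordinatewise_then_product)
  fix i show "continuous_on S (\<lambda>x. merge I J (z, x) i)"
    by (cases "i \<in> I"; cases "i \<in> J")
      (auto simp: merge_def intro: continuous_on_subset[OF continuous_on_product_coordinates])
qed

lemma compact_PiE:
  fixes S :: "'i \<Rightarrow> 'a::topological_space set"
  assumes "\<And>i. i \<in> I \<Longrightarrow> compact (S i)"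
  shows "compact (PiE I S)"
proof -
  have "PiE I S = PiE UNIV (\<lambda>i. if i \<in> I then S i else {undefined})"
    by (fastforce simp: PiE_def extensional_def Pi_def split: if_splits)
  moreover have "compactin (product_topology (\<lambda>_. euclidean) UNIV)
      (PiE UNIV (\<lambda>i. if i \<in> I then S i else {undefined}))"
    unfolding compactin_PiE using assms by (auto simp: compactin_euclidean_iff)
  ultimately show ?thesis
    by (simp add: euclidean_product_topology flip: compactin_euclidean_iff)
qed

lemma closed_PiE_Icc:
  fixes a b :: "'i::countable \<Rightarrow> real"
  shows "closed (PiE I (\<lambda>i. {a i..b i}))"
  by (rule compact_imp_closed, rule compact_PiE) simp

lemma bounded_on_compact_PiE:
  fixes f :: "('i \<Rightarrow> 'a::topological_space) \<Rightarrow> real"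
  assumes "continuous_on UNIV f" "\<And>i. i \<in> I \<Longrightarrow> compact (S i)"
  shows "\<exists>B. \<forall>x\<in>PiE I S. \<bar>f x\<bar> \<le> B"
proof -
  have "compact (f ` PiE I S)"
    using continuous_on_subset[OF assms(1)] assms(2)
    by (intro compact_continuous_image compact_PiE) auto
  then have "bounded (f ` PiE I S)" by (rule compact_imp_bounded)
  then show ?thesis by (auto simp: bounded_iff)
qed

section \<open>Product measures\<close>

lemma (in sigma_finite_measure) sigma_finite_scale_measure:
  assumes "r < top"
  shows "sigma_finite_measure (scale_measure r M)"
proof
  obtain A where "countable A" "A \<subseteq> sets M" "\<Union>A = space M" "\<And>a. a \<in> A \<Longrightarrow> emeasure M a \<noteq> \<infinity>"
    using sigma_finite_countable by blast
  with assms show "\<exists>A. countable A \<and> A \<subseteq> sets (scale_measure r M) \<and>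
      \<Union>A = space (scale_measure r M) \<and> (\<forall>a\<in>A. emeasure (scale_measure r M) a \<noteq> \<infinity>)"
    by (intro exI[of _ A]) (auto simp: space_scale_measure ennreal_mult_eq_top_iff)
qed

lemma (in product_sigma_finite) PiM_scale_measure:
  assumes I: "finite I" and r: "r < top"
  shows "PiM I (\<lambda>i. scale_measure r (M i)) = scale_measure (r ^ card I) (PiM I M)"
proof -
  interpret scaled: product_sigma_finite "\<lambda>i. scale_measure r (M i)"
    unfolding product_sigma_finite_def using sigma_finite_scale_measure[OF r] by blast
  show ?thesis
  proof (rule scaled.PiM_eqI[OF I, symmetric])
    show "sets (scale_measure (r ^ card I) (PiM I M)) = sets (PiM I (\<lambda>i. scale_measure r (M i)))"
      unfolding sets_scale_measure by (rule sets_PiM_cong) simp_all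
    show "emeasure (scale_measure (r ^ card I) (PiM I M)) (PiE I A) =
        (\<Prod>i\<in>I. emeasure (scale_measure r (M i)) (A i))"
      if "\<And>i. i \<in> I \<Longrightarrow> A i \<in> sets (scale_measure r (M i))" for A
      using that by (simp add: emeasure_PiM[OF I] prod.distrib)
  qed
qed

lemma (in product_sigma_finite) emeasure_PiM_restrict_space:
  assumes I: "finite I" and \<Omega>: "\<And>i. \<Omega> i \<in> sets (M i)"
    and E: "E \<in> sets (PiM I (\<lambda>i. restrict_space (M i) (\<Omega> i)))"
  shows "emeasure (PiM I (\<lambda>i. restrict_space (M i) (\<Omega> i))) E = emeasure (PiM I M) E"
proof -
  let ?R = "\<lambda>i. restrict_space (M i) (\<Omega> i)"
  let ?X = "restrict_space (PiM I M) (PiE I \<Omega>)"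
  interpret restr: product_sigma_finite ?R
    unfolding product_sigma_finite_def
    using sigma_finite_measure_restrict_space[OF sigma_finite_measures \<Omega>] by blast
  have box: "PiE I \<Omega> \<inter> space (PiM I M) \<in> sets (PiM I M)"
    using I \<Omega> by (intro sets.Int sets_PiM_I_finite) auto
  have space_X: "space ?X = PiE I \<Omega>"
    using \<Omega>[THEN sets.sets_into_space] by (auto simp: space_restrict_space space_PiM)
  have id: "(\<lambda>x. \<lambda>i\<in>I. x i) \<in> measurable ?X (PiM I ?R)"
    by (intro measurable_restrict measurable_restrict_space2 measurable_restrict_space1
        measurable_component_singleton)
       (auto simp: space_X)
  have restrict_vimage: "(\<lambda>x. \<lambda>i\<in>I. x i) -` B \<inter> space ?X = B" if "B \<subseteq> PiE I \<Omega>" for B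
    using that by (force simp: space_X PiE_restrict)
  have emeasure_distr_X: "emeasure (distr ?X (PiM I ?R) (\<lambda>x. \<lambda>i\<in>I. x i)) B = emeasure (PiM I M) B"
    if B: "B \<in> sets (PiM I ?R)" for B
  proof -
    have "B \<subseteq> PiE I \<Omega>"
      using sets.sets_into_space[OF B] \<Omega>[THEN sets.sets_into_space]
      by (auto simp: space_PiM space_restrict_space PiE_def Pi_def)
    then show ?thesis
      using B box by (simp add: emeasure_distr[OF id] restrict_vimage emeasure_restrict_space)
  qed
  have "distr ?X (PiM I ?R) (\<lambda>x. \<lambda>i\<in>I. x i) = PiM I ?R"
  proof (rule restr.PiM_eqI[OF I])
    fix A assume A: "A i \<in> sets (?R i)" if "i \<in> I" for i
    then have "A i \<in> sets (M i)" "A i \<subseteq> \<Omega> i" if "i \<in> I" for i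
      using that \<Omega> by (auto simp: sets_restrict_space_iff)
    then show "emeasure (distr ?X (PiM I ?R) (\<lambda>x. \<lambda>i\<in>I. x i)) (PiE I A) =
        (\<Prod>i\<in>I. emeasure (?R i) (A i))"
      using A I \<Omega>
      by (simp add: emeasure_distr_X sets_PiM_I_finite emeasure_PiM emeasure_restrict_space)
  qed simp
  with emeasure_distr_X[OF E] show ?thesis by simp
qed

lemma distr_PiM_coordinatewise:
  fixes c :: "'i \<Rightarrow> 'j"
  assumes M: "sigma_finite_measure M" and T: "T \<in> measurable M N"
    and distr: "sigma_finite_measure (distr M N T)"
    and J: "finite J" and c: "bij_betw c J K"
  shows "distr (PiM K (\<lambda>_. M)) (PiM J (\<lambda>_. N)) (\<lambda>y. \<lambda>i\<in>J. T (y (c i))) = PiM J (\<lambda>_. distr M N T)"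
proof -
  interpret dom: product_sigma_finite "\<lambda>_::'j. M"
    using M by (simp add: product_sigma_finite_def)
  interpret cod: product_sigma_finite "\<lambda>_::'i. distr M N T"
    using distr by (simp add: product_sigma_finite_def)
  let ?\<Phi> = "\<lambda>y. \<lambda>i\<in>J. T (y (c i))"
  have K: "finite K" and cJ: "\<And>i. i \<in> J \<Longrightarrow> c i \<in> K"
    using J c by (auto simp: bij_betw_def)
  have \<Phi>: "?\<Phi> \<in> measurable (PiM K (\<lambda>_. M)) (PiM J (\<lambda>_. N))"
    using T cJ
    by (intro measurable_restrict measurable_compose[OF measurable_component_singleton]) auto
  show ?thesis
  proof (rule cod.PiM_eqI[OF J])
    show "sets (distr (PiM K (\<lambda>_. M)) (PiM J (\<lambda>_. N)) ?\<Phi>) = sets (PiM J (\<lambda>_. distr M N T))"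
      unfolding sets_distr by (rule sets_PiM_cong) simp_all
  next
    fix A assume "\<And>i. i \<in> J \<Longrightarrow> A i \<in> sets (distr M N T)"
    then have A: "A i \<in> sets N" if "i \<in> J" for i
      using that by simp
    define B where "B k = T -` A (the_inv_into J c k) \<inter> space M" for k
    have B_c: "B (c i) = T -` A i \<inter> space M" if "i \<in> J" for i
      using that c by (simp add: B_def bij_betw_def the_inv_into_f_f)
    have B: "B k \<in> sets M" if "k \<in> K" for k
      using that c A T by (auto simp: bij_betw_def B_c intro: measurable_sets)
    have "?\<Phi> -` PiE J A \<inter> space (PiM K (\<lambda>_. M)) = PiE K B"
      using c by (auto simp: bij_betw_def space_PiM PiE_iff B_c)
    then have "emeasure (distr (PiM K (\<lambda>_. M)) (PiM J (\<lambda>_. N)) ?\<Phi>) (PiE J A) =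
        (\<Prod>k\<in>K. emeasure M (B k))"
      using A B J K by (simp add: emeasure_distr[OF \<Phi>] sets_PiM_I_finite dom.emeasure_PiM)
    also have "\<dots> = (\<Prod>i\<in>J. emeasure M (B (c i)))"
      by (rule prod.reindex_bij_betw[OF c, symmetric])
    also have "\<dots> = (\<Prod>i\<in>J. emeasure (distr M N T) (A i))"
      using A by (simp add: B_c emeasure_distr[OF T])
    finally show "emeasure (distr (PiM K (\<lambda>_. M)) (PiM J (\<lambda>_. N)) ?\<Phi>) (PiE J A) =
        (\<Prod>i\<in>J. emeasure (distr M N T) (A i))" .
  qed
qed

lemma (in product_sigma_finite)
  assumes IJ: "finite I" "finite J" "I \<inter> J = {}" and S: "S \<in> sets (PiM (I \<union> J) M)"
  shows measurable_emeasure_merge: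
      "(\<lambda>z. emeasure (PiM J M) {x \<in> space (PiM J M). merge I J (z, x) \<in> S})
          \<in> borel_measurable (PiM I M)"
    and emeasure_PiM_merge: "emeasure (PiM (I \<union> J) M) S =
      (\<integral>\<^sup>+ z. emeasure (PiM J M) {x \<in> space (PiM J M). merge I J (z, x) \<in> S} \<partial>PiM I M)"
proof -
  interpret I: sigma_finite_measure "PiM I M" by (rule sigma_finite[OF IJ(1)])
  interpret J: sigma_finite_measure "PiM J M" by (rule sigma_finite[OF IJ(2)])
  let ?S = "merge I J -` S \<inter> space (PiM I M \<Otimes>\<^sub>M PiM J M)"
  have vimage: "?S \<in> sets (PiM I M \<Otimes>\<^sub>M PiM J M)"
    using S by (rule measurable_sets[OF measurable_merge])
  have slice: "Pair z -` ?S = {x \<in> space (PiM J M). merge I J (z, x) \<in> S}"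
      if "z \<in> space (PiM I M)" for z
    using that by (auto simp: space_pair_measure)
  show "(\<lambda>z. emeasure (PiM J M) {x \<in> space (PiM J M). merge I J (z, x) \<in> S})
      \<in> borel_measurable (PiM I M)"
    using J.measurable_emeasure_Pair[OF vimage]
    by (subst measurable_cong[OF arg_cong[OF slice[symmetric]]])
  have "emeasure (PiM (I \<union> J) M) S = emeasure (PiM I M \<Otimes>\<^sub>M PiM J M) ?S"
    by (subst distr_merge[OF IJ(3,1,2), symmetric]) (rule emeasure_distr[OF measurable_merge S])
  also have "\<dots> = (\<integral>\<^sup>+ z. emeasure (PiM J M) {x \<in> space (PiM J M). merge I J (z, x) \<in> S} \<partial>PiM I M)"
    unfolding J.emeasure_pair_measure_alt[OF vimage] by (intro nn_integral_cong arg_cong[OF slice])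
  finally show "emeasure (PiM (I \<union> J) M) S =
      (\<integral>\<^sup>+ z. emeasure (PiM J M) {x \<in> space (PiM J M). merge I J (z, x) \<in> S} \<partial>PiM I M)" .
qed

lemma (in sigma_finite_measure)
  fixes f :: "'a \<Rightarrow> real"
  assumes f[measurable]: "f \<in> borel_measurable M"
  shows measurable_emeasure_superlevel:
      "(\<lambda>t. emeasure M {x \<in> space M. 0 < t \<and> t \<le> f x}) \<in> borel_measurable lborel"
    and nn_integral_layer_cake:
      "(\<integral>\<^sup>+ x. ennreal (f x) \<partial>M) = (\<integral>\<^sup>+ t. emeasure M {x \<in> space M. 0 < t \<and> t \<le> f x} \<partial>lborel)"
proof -
  interpret P: pair_sigma_finite lborel M ..
  let ?S = "{p \<in> space (lborel \<Otimes>\<^sub>M M). 0 < fst p \<and> fst p \<le> f (snd p)}"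
  have S: "?S \<in> sets (lborel \<Otimes>\<^sub>M M)" by measurable
  have slice: "Pair t -` ?S = {x \<in> space M. 0 < t \<and> t \<le> f x}" for t
    by (auto simp: space_pair_measure)
  show "(\<lambda>t. emeasure M {x \<in> space M. 0 < t \<and> t \<le> f x}) \<in> borel_measurable lborel"
    using measurable_emeasure_Pair[OF S] by (simp add: slice)
  have "(\<integral>\<^sup>+ x. ennreal (f x) \<partial>M) = (\<integral>\<^sup>+ x. emeasure lborel ((\<lambda>t. (t, x)) -` ?S) \<partial>M)"
  proof (rule nn_integral_cong)
    fix x assume "x \<in> space M"
    then have "(\<lambda>t. (t, x)) -` ?S = {0<..f x}" by (auto simp: space_pair_measure)
    moreover have "ennreal (f x) = emeasure lborel {0<..f x}"
      by (cases "0 \<le> f x") (auto simp: ennreal_neg)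
    ultimately show "ennreal (f x) = emeasure lborel ((\<lambda>t. (t, x)) -` ?S)" by simp
  qed
  also have "\<dots> = emeasure (lborel \<Otimes>\<^sub>M M) ?S"
    by (rule P.emeasure_pair_measure_alt2[OF S, symmetric])
  also have "\<dots> = (\<integral>\<^sup>+ t. emeasure M {x \<in> space M. 0 < t \<and> t \<le> f x} \<partial>lborel)"
    unfolding emeasure_pair_measure_alt[OF S] slice ..
  finally show "(\<integral>\<^sup>+ x. ennreal (f x) \<partial>M) =
      (\<integral>\<^sup>+ t. emeasure M {x \<in> space M. 0 < t \<and> t \<le> f x} \<partial>lborel)" .
qed

lemma nn_integral_le_sum_superlevel:
  fixes f :: "'a \<Rightarrow> real" and h :: "'i \<Rightarrow> 'b \<Rightarrow> real"
  assumes M: "sigma_finite_measure M" and f: "f \<in> borel_measurable M"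
    and N: "\<And>j. j \<in> J \<Longrightarrow> sigma_finite_measure (N j)"
    and h: "\<And>j. j \<in> J \<Longrightarrow> h j \<in> borel_measurable (N j)"
    and le: "\<And>t. 0 < t \<Longrightarrow> c * emeasure M {x \<in> space M. t \<le> f x} \<le>
      (\<Sum>j\<in>J. emeasure (N j) {x \<in> space (N j). t \<le> h j x})"
  shows "c * (\<integral>\<^sup>+ x. ennreal (f x) \<partial>M) \<le> (\<Sum>j\<in>J. \<integral>\<^sup>+ x. ennreal (h j x) \<partial>N j)"
proof -
  have positive_level: "c * emeasure M {x \<in> space M. 0 < t \<and> t \<le> f x} \<le>
      (\<Sum>j\<in>J. emeasure (N j) {x \<in> space (N j). 0 < t \<and> t \<le> h j x})" for t
    using le[of t] by (cases "0 < t") auto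
  have "c * (\<integral>\<^sup>+ x. ennreal (f x) \<partial>M) =
      (\<integral>\<^sup>+ t. c * emeasure M {x \<in> space M. 0 < t \<and> t \<le> f x} \<partial>lborel)"
    unfolding sigma_finite_measure.nn_integral_layer_cake[OF M f]
    by (intro nn_integral_cmult[symmetric] sigma_finite_measure.measurable_emeasure_superlevel M f)
  also have "\<dots> \<le> (\<integral>\<^sup>+ t. (\<Sum>j\<in>J. emeasure (N j) {x \<in> space (N j). 0 < t \<and> t \<le> h j x}) \<partial>lborel)"
    by (intro nn_integral_mono positive_level)
  also have "\<dots> = (\<Sum>j\<in>J. \<integral>\<^sup>+ t. emeasure (N j) {x \<in> space (N j). 0 < t \<and> t \<le> h j x} \<partial>lborel)"
    by (intro nn_integral_sum sigma_finite_measure.measurable_emeasure_superlevel N h)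
  also have "\<dots> = (\<Sum>j\<in>J. \<integral>\<^sup>+ x. ennreal (h j x) \<partial>N j)"
    by (intro sum.cong refl sigma_finite_measure.nn_integral_layer_cake[symmetric] N h)
  finally show ?thesis .
qed

lemma borel_measurable_completion_AE:
  fixes f g :: "'a \<Rightarrow> 'b::topological_space"
  assumes g: "g \<in> borel_measurable M" and eq: "AE x in M. f x = g x"
  shows "f \<in> borel_measurable (completion M)"
proof (rule measurableI)
  fix A :: "'b set" assume A: "A \<in> sets borel"
  have "AE x in completion M. (x \<in> g -` A \<inter> space M) = (x \<in> f -` A \<inter> space M)"
    using AE_completion[OF eq] by eventually_elim auto
  moreover have "g -` A \<inter> space M \<in> sets (completion M)"
    using measurable_sets[OF g A] by simp
  ultimately show "f -` A \<inter> space (completion M) \<in> sets (completion M)"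
    using complete_measure.in_sets_AE[OF completion.complete_measure_axioms,
        of "g -` A \<inter> space M" "f -` A \<inter> space M"]
    by simp
qed simp

section \<open>The uniform measure on a cube\<close>

abbreviation unit_lborel :: "real measure" where
  "unit_lborel \<equiv> restrict_space lborel {0..1}"

abbreviation cubeM :: "nat set \<Rightarrow> (nat \<Rightarrow> real) measure" where
  "cubeM I \<equiv> PiM I (\<lambda>_. unit_lborel)"

lemma prob_space_unit_lborel: "prob_space unit_lborel"
  by (rule prob_spaceI) (simp add: emeasure_restrict_space space_restrict_space)

interpretation unit: prob_space unit_lborel
  by (rule prob_space_unit_lborel)

interpretation cube: product_sigma_finite "\<lambda>_::nat. unit_lborel"
  by standard

interpretation box: product_sigma_finite "\<lambda>_::nat. lborel :: real measure"
  by standard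

interpretation unit_cube: prob_space "cubeM I" for I
  by (rule prob_space_PiM) (rule prob_space_unit_lborel)

lemma space_cubeM: "space (cubeM I) = PiE I (\<lambda>_. {0..1})"
  by (simp add: space_PiM space_restrict_space)

lemma space_cubeM_lessThan: "space (cubeM {..<m}) = cube m"
  by (simp add: space_cubeM cube_def)

lemma borel_measurable_cubeM:
  assumes "f \<in> borel_measurable borel"
  shows "f \<in> borel_measurable (cubeM I)"
proof -
  have "(\<lambda>x. x) \<in> borel_measurable (cubeM I)"
  proof (rule measurable_coordinatewise_then_product)
    fix i
    show "(\<lambda>x. x i) \<in> borel_measurable (cubeM I)"
    proof (cases "i \<in> I")
      case True
      then have "(\<lambda>x. x i) \<in> measurable (cubeM I) unit_lborel" by measurable
      then show ?thesis by (simp add: measurable_restrict_space2_iff)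
    next
      case False
      have "(\<lambda>x. x i) \<in> borel_measurable (cubeM I) \<longleftrightarrow>
          (\<lambda>x. undefined :: real) \<in> borel_measurable (cubeM I)"
        by (rule measurable_cong) (use False in \<open>auto simp: space_PiM\<close>)
      then show ?thesis by simp
    qed
  qed
  from measurable_compose[OF this assms] show ?thesis .
qed

lemma borel_measurable_cubeM_fun_upd:
  assumes f: "f \<in> borel_measurable borel"
  shows "(\<lambda>x. f (x(j := c))) \<in> borel_measurable (cubeM I)"
  by (intro borel_measurable_cubeM measurable_compose[OF _ f] borel_measurable_continuous_onI
      continuous_intros continuous_on_id)

lemma sets_cubeM_borel:
  assumes "E \<in> sets borel"
  shows "{x \<in> space (cubeM I). x \<in> E} \<in> sets (cubeM I)"
  using measurable_sets[OF borel_measurable_cubeM[OF measurable_ident] assms]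
  by (simp add: vimage_def Int_def conj_commute)

lemma sets_cubeM_closed:
  assumes "closed E" "E \<subseteq> PiE I (\<lambda>_. {0..1})"
  shows "E \<in> sets (cubeM I)"
proof -
  have "{x \<in> space (cubeM I). x \<in> E} = E" using assms(2) by (auto simp: space_cubeM)
  with sets_cubeM_borel[OF borel_closed[OF assms(1)], of I] show ?thesis by simp
qed

lemma bounded_on_cube:
  fixes f :: "(nat \<Rightarrow> real) \<Rightarrow> real"
  assumes "continuous_on UNIV f"
  shows "\<exists>B. \<forall>x\<in>PiE I (\<lambda>_. {0..1}). \<bar>f x\<bar> \<le> B"
  by (rule bounded_on_compact_PiE[OF assms compact_Icc])

lemma integrable_cubeM_continuous:
  fixes f :: "(nat \<Rightarrow> real) \<Rightarrow> real"
  assumes f: "continuous_on UNIV f"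
  shows "integrable (cubeM I) f"
proof -
  obtain B where "\<And>x. x \<in> PiE I (\<lambda>_. {0..1}) \<Longrightarrow> \<bar>f x\<bar> \<le> B"
    using bounded_on_cube[OF f] by blast
  then show ?thesis
    using borel_measurable_cubeM[OF borel_measurable_continuous_onI[OF f]]
    by (intro unit_cube.integrable_const_bound[where B = B]) (auto simp: space_cubeM)
qed

lemma continuous_on_compose_fun_upd:
  fixes f :: "(nat \<Rightarrow> real) \<Rightarrow> real"
  assumes "continuous_on UNIV f" "continuous_on UNIV h"
  shows "continuous_on UNIV (\<lambda>x. f (x(j := h x)))"
  by (intro continuous_on_compose2[OF assms(1)] continuous_intros continuous_on_id assms(2)) auto

lemma integrable_cubeM_fun_upd:
  fixes f :: "(nat \<Rightarrow> real) \<Rightarrow> real"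
  assumes "continuous_on UNIV f"
  shows "integrable (cubeM I) (\<lambda>x. f (x(j := c)))"
  by (rule integrable_cubeM_continuous)
    (rule continuous_on_compose_fun_upd[OF assms continuous_on_const])

lemma measurable_reflect_unit:
  assumes "0 < N"
  shows "(\<lambda>t. 1 - t / N) \<in> measurable (restrict_space lborel {0..N}) unit_lborel"
  using assms
  by (intro measurable_restrict_space2 measurable_restrict_space1) (auto simp: space_restrict_space)

lemma distr_reflect_lborel:
  assumes N: "0 < N"
  shows "distr (restrict_space lborel {0..N}) unit_lborel (\<lambda>t. 1 - t / N) =
    scale_measure (ennreal N) unit_lborel"
    (is "distr ?R _ ?T = _")
proof (rule measure_eqI)
  fix A assume "A \<in> sets (distr ?R unit_lborel ?T)"
  then have A: "A \<in> sets unit_lborel" by simp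
  then have A_borel: "A \<in> sets borel" "A \<subseteq> {0..1}"
    by (auto simp: sets_restrict_space)
  note T = measurable_reflect_unit[OF N]
  have indicator_eq:
    "indicator A (1 + (- 1 / N) * t) = (indicator (?T -` A \<inter> {0..N}) t :: ennreal)" for t
    using A_borel N by (auto simp: indicator_def subset_iff field_simps)
  have "emeasure unit_lborel A = (\<integral>\<^sup>+ t. indicator A t \<partial>lborel)"
    using A_borel by (simp add: emeasure_restrict_space)
  also have "\<dots> = ennreal (1 / N) * (\<integral>\<^sup>+ t. indicator A (1 + (- 1 / N) * t) \<partial>lborel)"
    using A_borel N nn_integral_real_affine[of "indicator A" "- 1 / N" 1] by simp
  also have "(\<integral>\<^sup>+ t. indicator A (1 + (- 1 / N) * t) \<partial>lborel) = emeasure lborel (?T -` A \<inter> {0..N})"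
    unfolding indicator_eq using measurable_sets_borel[OF _ A_borel(1), of ?T]
    by (intro nn_integral_indicator) auto
  also have "\<dots> = emeasure (distr ?R unit_lborel ?T) A"
    using emeasure_distr[OF T A] by (simp add: emeasure_restrict_space space_restrict_space)
  finally have "emeasure unit_lborel A = ennreal (1 / N) * emeasure (distr ?R unit_lborel ?T) A" .
  then show "emeasure (distr ?R unit_lborel ?T) A =
      emeasure (scale_measure (ennreal N) unit_lborel) A"
    using N by (simp add: mult.assoc[symmetric] ennreal_mult[symmetric])
qed simp

section \<open>Bodies of nonpositive deficiency\<close>

definition deficiency_free :: "real \<Rightarrow> nat \<Rightarrow> (nat \<Rightarrow> real) set \<Rightarrow> bool" where
  "deficiency_free k r S \<longleftrightarrow> (\<forall>A. body r A \<and> A \<subseteq> S \<longrightarrow> deficiency k r A \<le> 0)"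

definition top_face :: "nat set \<Rightarrow> nat \<Rightarrow> (nat \<Rightarrow> real) set \<Rightarrow> (nat \<Rightarrow> real) set" where
  "top_face I j S = {x \<in> PiE (I - {j}) (\<lambda>_. {0..1}). x(j := 1) \<in> S}"

definition top_closed :: "nat set \<Rightarrow> (nat \<Rightarrow> real) set \<Rightarrow> bool" where
  "top_closed J E \<longleftrightarrow> (\<forall>x\<in>E. \<forall>j\<in>J. x(j := 1) \<in> E)"

definition SIM_corner :: "real \<Rightarrow> (nat \<Rightarrow> real) \<Rightarrow> nat set \<Rightarrow> (nat \<Rightarrow> real) set" where
  "SIM_corner N \<alpha> J = {x. \<forall>L. L \<subseteq> J \<longrightarrow>
    N * (\<Sum>i\<in>L. 1 - x i) \<le> (\<Sum>i\<in>{card J - card L + 1..card J}. \<alpha> i)}"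

text \<open>The image of \<open>E\<close> under \<open>x \<mapsto> N (1 - x)\<close>, with the coordinates relabelled by \<open>c\<close>.\<close>

definition corner_body ::
    "real \<Rightarrow> (nat \<Rightarrow> nat) \<Rightarrow> nat set \<Rightarrow> (nat \<Rightarrow> real) set \<Rightarrow> (nat \<Rightarrow> real) set" where
  "corner_body N c J E = {y \<in> PiE (c ` J) (\<lambda>_. {0..N}). (\<lambda>i\<in>J. 1 - y (c i) / N) \<in> E}"

lemma sets_top_face:
  assumes "closed S"
  shows "top_face I j S \<in> sets (cubeM (I - {j}))"
proof (rule sets_cubeM_closed)
  have "top_face I j S = PiE (I - {j}) (\<lambda>_. {0..1}) \<inter> (\<lambda>x. x(j := 1)) -` S"
    by (auto simp: top_face_def)
  also have "closed \<dots>"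
    using assms
    by (intro closed_Int closed_PiE_Icc closed_vimage continuous_intros continuous_on_id)
  finally show "closed (top_face I j S)" .
qed (auto simp: top_face_def)

lemma emeasure_corner_body:
  assumes N: "0 < N" and J: "finite J" and c: "inj_on c J" and E: "E \<in> sets (cubeM J)"
  shows "emeasure (PiM (c ` J) (\<lambda>_. lborel)) (corner_body N c J E) =
      ennreal N ^ card J * emeasure (cubeM J) E"
proof -
  let ?R = "restrict_space lborel {0..N}" and ?T = "\<lambda>t::real. 1 - t / N"
  let ?\<Phi> = "\<lambda>y. \<lambda>i\<in>J. ?T (y (c i))"
  note T = measurable_reflect_unit[OF N]
  have \<Phi>: "?\<Phi> \<in> measurable (PiM (c ` J) (\<lambda>_. ?R)) (cubeM J)"
    using T
    by (intro measurable_restrict measurable_compose[OF measurable_component_singleton]) auto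
  have vimage: "corner_body N c J E = ?\<Phi> -` E \<inter> space (PiM (c ` J) (\<lambda>_. ?R))"
    by (auto simp: corner_body_def space_PiM space_restrict_space)
  have "emeasure (PiM (c ` J) (\<lambda>_. lborel)) (corner_body N c J E) =
      emeasure (PiM (c ` J) (\<lambda>_. ?R)) (corner_body N c J E)"
    using J measurable_sets[OF \<Phi> E] unfolding vimage
    by (intro box.emeasure_PiM_restrict_space[symmetric]) auto
  also have "\<dots> = emeasure (distr (PiM (c ` J) (\<lambda>_. ?R)) (cubeM J) ?\<Phi>) E"
    unfolding vimage by (rule emeasure_distr[OF \<Phi> E, symmetric])
  also have "distr (PiM (c ` J) (\<lambda>_. ?R)) (cubeM J) ?\<Phi> =
      PiM J (\<lambda>_. scale_measure (ennreal N) unit_lborel)"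
    unfolding distr_reflect_lborel[OF N, symmetric]
  proof (rule distr_PiM_coordinatewise)
    show "sigma_finite_measure ?R"
      by (rule sigma_finite_measure_restrict_space) (auto intro: sigma_finite_lborel)
    show "sigma_finite_measure (distr ?R unit_lborel ?T)"
      unfolding distr_reflect_lborel[OF N] by (rule unit.sigma_finite_scale_measure) simp
    show "bij_betw c J (c ` J)" using c by (simp add: bij_betw_def)
  qed (use T J in auto)
  also have "emeasure (PiM J (\<lambda>_. scale_measure (ennreal N) unit_lborel)) E =
      ennreal N ^ card J * emeasure (cubeM J) E"
    by (simp add: cube.PiM_scale_measure[OF J])
  finally show ?thesis .
qed

lemma body_corner_body:
  assumes "closed E" and c: "c ` J = {..<r}"
  shows "body r (corner_body N c J E)"
proof -
  have "corner_body N c J E = PiE (c ` J) (\<lambda>_. {0..N}) \<inter> (\<lambda>y. \<lambda>i\<in>J. 1 - y (c i) / N) -` E"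
    by (auto simp: corner_body_def)
  moreover have "continuous_on UNIV (\<lambda>y. \<lambda>i\<in>J. 1 - y (c i) / N)"
  proof (rule continuous_on_coordinatewise_then_product)
    fix i show "continuous_on UNIV (\<lambda>y. (\<lambda>i\<in>J. 1 - y (c i) / N) i)"
      by (cases "i \<in> J") (auto simp: divide_inverse intro!: continuous_intros)
  qed
  ultimately have "compact (corner_body N c J E)"
    using assms by (auto intro!: compact_Int_closed compact_PiE closed_vimage)
  then show ?thesis by (auto simp: body_def corner_body_def c PiE_def Pi_def)
qed

lemma corner_body_subset_SIM_body:
  assumes N: "0 < N" and c: "bij_betw c J {..<card J}" and E: "E \<subseteq> SIM_corner N \<alpha> J"
  shows "corner_body N c J E \<subseteq> SIM_body (card J) \<alpha>"
proof
  fix y assume y: "y \<in> corner_body N c J E"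
  define x where "x = (\<lambda>i\<in>J. 1 - y (c i) / N)"
  have x: "x \<in> SIM_corner N \<alpha> J" using y E by (auto simp: corner_body_def x_def)
  have "(\<Sum>k\<in>K. y k) \<le> (\<Sum>k\<in>{card J - card K + 1..card J}. \<alpha> k)" if K: "K \<subseteq> {..<card J}" for K
  proof -
    define L where "L = {i \<in> J. c i \<in> K}"
    have L: "bij_betw c L K"
      using c K by (auto simp: bij_betw_def L_def inj_on_def)
    have "(\<Sum>k\<in>K. y k) = (\<Sum>i\<in>L. y (c i))"
      by (rule sum.reindex_bij_betw[OF L, symmetric])
    also have "\<dots> = N * (\<Sum>i\<in>L. 1 - x i)"
      using N by (auto simp: x_def L_def sum_distrib_left intro!: sum.cong)
    also have "\<dots> \<le> (\<Sum>k\<in>{card J - card L + 1..card J}. \<alpha> k)"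
      using x by (simp add: SIM_corner_def L_def)
    finally show ?thesis by (simp add: bij_betw_same_card[OF L])
  qed
  moreover have "c ` J = {..<card J}" using c by (simp add: bij_betw_def)
  ultimately show "y \<in> SIM_body (card J) \<alpha>"
    using y by (auto simp: SIM_body_def corner_body_def PiE_iff)
qed

lemma restrict_corner_body:
  assumes N: "0 < N" and c: "inj_on c J" and j: "j \<in> J" and E: "E \<subseteq> PiE J (\<lambda>_. {0..1})"
    and top: "top_closed J E"
  shows "(\<lambda>y. restrict y (c ` J - {c j})) ` corner_body N c J E =
    corner_body N c (J - {j}) (top_face J j E)"
proof -
  have image_diff: "c ` (J - {j}) = c ` J - {c j}"
    using c j by (auto simp: inj_on_def)
  show ?thesis
  proof (intro set_eqI iffI)
    fix y assume "y \<in> (\<lambda>y. restrict y (c ` J - {c j})) ` corner_body N c J E"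
    then obtain z where z: "z \<in> corner_body N c J E" and y: "y = restrict z (c ` J - {c j})" by auto
    define x where "x = (\<lambda>i\<in>J. 1 - z (c i) / N)"
    have x: "x \<in> E" using z by (simp add: corner_body_def x_def)
    have "(\<lambda>i\<in>J - {j}. 1 - y (c i) / N) = restrict x (J - {j})"
      using c j by (auto simp: y x_def fun_eq_iff inj_on_def)
    moreover have "(restrict x (J - {j}))(j := 1) = x(j := 1)"
      by (auto simp: x_def fun_eq_iff)
    ultimately have "(\<lambda>i\<in>J - {j}. 1 - y (c i) / N) \<in> top_face J j E"
      using x E top j by (auto simp: top_face_def top_closed_def PiE_iff)
    moreover have "y \<in> PiE (c ` J - {c j}) (\<lambda>_. {0..N})"
      using z by (auto simp: y corner_body_def PiE_iff)
    ultimately show "y \<in> corner_body N c (J - {j}) (top_face J j E)"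
      by (simp add: corner_body_def image_diff)
  next
    fix y assume y: "y \<in> corner_body N c (J - {j}) (top_face J j E)"
    define z where "z = y(c j := 0)"
    have "(\<lambda>i\<in>J. 1 - z (c i) / N) = (\<lambda>i\<in>J - {j}. 1 - y (c i) / N)(j := 1)"
      using c j by (auto simp: fun_eq_iff z_def inj_on_def)
    then have "z \<in> corner_body N c J E"
      using y N j
      by (auto simp: corner_body_def top_face_def image_diff z_def PiE_iff extensional_def)
    moreover have "y = restrict z (c ` J - {c j})"
      using y by (auto simp: z_def fun_eq_iff corner_body_def image_diff PiE_iff extensional_def)
    ultimately show "y \<in> (\<lambda>y. restrict y (c ` J - {c j})) ` corner_body N c J E" by blast
  qed
qed

lemma deficiency_corner_body:
  assumes N: "0 < N" and J: "finite J" "J \<noteq> {}" and c: "bij_betw c J {..<card J}"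
    and E: "closed E" "E \<subseteq> PiE J (\<lambda>_. {0..1})"
    and top: "top_closed J E"
  shows "deficiency k (card J) (corner_body N c J E) = N ^ (card J - 1) *
    (N * measure (cubeM J) E - k * (\<Sum>j\<in>J. measure (cubeM (J - {j})) (top_face J j E)))"
proof -
  have inj: "inj_on c J" and image: "c ` J = {..<card J}" using c by (auto simp: bij_betw_def)
  have vol: "measure (PiM (c ` I) (\<lambda>_. lborel)) (corner_body N c I A) =
      N ^ card I * measure (cubeM I) A"
    if "I \<subseteq> J" "A \<in> sets (cubeM I)" for I A
    using N emeasure_corner_body[OF N finite_subset[OF that(1) J(1)]
        inj_on_subset[OF inj that(1)] that(2)]
    by (simp add: measure_def enn2real_mult ennreal_power)
  have face_vol: "measure (PiM ({..<card J} - {c j}) (\<lambda>_. lborel))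
      ((\<lambda>y. restrict y ({..<card J} - {c j})) ` corner_body N c J E) =
    N ^ (card J - 1) * measure (cubeM (J - {j})) (top_face J j E)" if j: "j \<in> J" for j
  proof -
    have "c ` (J - {j}) = {..<card J} - {c j}" using inj image j by (auto simp: inj_on_def)
    then show ?thesis
      using restrict_corner_body[OF N inj j E(2) top]
        vol[of "J - {j}", OF _ sets_top_face[OF E(1)]] J(1) j
      by (simp add: image)
  qed
  have "deficiency k (card J) (corner_body N c J E) = N ^ card J * measure (cubeM J) E -
      k * (\<Sum>j\<in>J. N ^ (card J - 1) * measure (cubeM (J - {j})) (top_face J j E))"
    using vol[OF subset_refl sets_cubeM_closed[OF E]]
    by (simp add: deficiency_def image face_vol flip: sum.reindex_bij_betw[OF c])
  moreover have "N ^ card J = N ^ (card J - 1) * N"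
    using J by (simp add: power_eq_if)
  ultimately show ?thesis
    by (simp add: algebra_simps flip: sum_distrib_left)
qed

lemma emeasure_le_sum_top_faces:
  assumes N: "0 < N" and J: "finite J" "J \<noteq> {}"
    and E: "closed E" "E \<subseteq> PiE J (\<lambda>_. {0..1})" "top_closed J E" "E \<subseteq> SIM_corner N \<alpha> J"
    and free: "deficiency_free 1 (card J) (SIM_body (card J) \<alpha>)"
  shows "ennreal N * emeasure (cubeM J) E \<le> (\<Sum>j\<in>J. emeasure (cubeM (J - {j})) (top_face J j E))"
proof -
  obtain c where c: "bij_betw c J {..<card J}"
    using ex_bij_betw_finite_nat[OF J(1)] by (auto simp: atLeast0LessThan)
  have "body (card J) (corner_body N c J E)"
    using c by (intro body_corner_body E) (simp add: bij_betw_def)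
  moreover have "corner_body N c J E \<subseteq> SIM_body (card J) \<alpha>"
    by (rule corner_body_subset_SIM_body[OF N c E(4)])
  ultimately have "deficiency 1 (card J) (corner_body N c J E) \<le> 0"
    using free by (simp add: deficiency_free_def)
  then have "N * measure (cubeM J) E \<le> (\<Sum>j\<in>J. measure (cubeM (J - {j})) (top_face J j E))"
    using zero_less_power[OF N, of "card J - 1"]
    by (simp add: deficiency_corner_body[OF N J c E(1-3)] mult_le_0_iff)
  then have "ennreal (N * measure (cubeM J) E) \<le>
      ennreal (\<Sum>j\<in>J. measure (cubeM (J - {j})) (top_face J j E))"
    by (rule ennreal_leI)
  then show ?thesis
    using N by (simp add: unit_cube.emeasure_eq_measure ennreal_mult sum_ennreal)
qed

definition cube_slice ::
    "nat set \<Rightarrow> nat set \<Rightarrow> (nat \<Rightarrow> real) \<Rightarrow> (nat \<Rightarrow> real) set \<Rightarrow> (nat \<Rightarrow> real) set" where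
  "cube_slice I J z S = {x \<in> PiE J (\<lambda>_. {0..1}). merge I J (z, x) \<in> S}"

lemma
  assumes "finite I" "finite J" "I \<inter> J = {}" "S \<in> sets (cubeM (I \<union> J))"
  shows measurable_emeasure_cube_slice:
      "(\<lambda>z. emeasure (cubeM J) (cube_slice I J z S)) \<in> borel_measurable (cubeM I)"
    and emeasure_cubeM_slice:
      "emeasure (cubeM (I \<union> J)) S = (\<integral>\<^sup>+ z. emeasure (cubeM J) (cube_slice I J z S) \<partial>cubeM I)"
  using cube.measurable_emeasure_merge[OF assms] cube.emeasure_PiM_merge[OF assms]
  by (simp_all add: cube_slice_def space_cubeM)

lemma closed_cube_slice:
  assumes "closed S"
  shows "closed (cube_slice I J z S)"
proof -
  have "cube_slice I J z S = PiE J (\<lambda>_. {0..1}) \<inter> (\<lambda>x. merge I J (z, x)) -` S"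
    by (auto simp: cube_slice_def)
  with assms show ?thesis
    by (auto intro!: closed_Int closed_PiE_Icc closed_vimage continuous_on_merge)
qed

lemma cube_slice_top_face:
  assumes "I \<inter> J = {}" "j \<in> J" "z \<in> space (cubeM I)"
  shows "cube_slice I (J - {j}) z (top_face (I \<union> J) j S) = top_face J j (cube_slice I J z S)"
proof -
  have "(merge I (J - {j}) (z, x))(j := 1) = merge I J (z, x(j := 1))" for x :: "nat \<Rightarrow> real"
    using assms by (auto simp: merge_def fun_eq_iff)
  moreover have "merge I (J - {j}) (z, x) \<in> PiE (I \<union> J - {j}) (\<lambda>_. {0..1})"
    if "x \<in> PiE (J - {j}) (\<lambda>_. {0..1})" for x
    using that assms by (auto simp: space_cubeM merge_def PiE_def Pi_def extensional_def)
  moreover have "x(j := 1) \<in> PiE J (\<lambda>_. {0..1})"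
    if "x \<in> PiE (J - {j}) (\<lambda>_. {0..1})" for x :: "nat \<Rightarrow> real"
    using PiE_fun_upd[OF _ that, of 1 j] assms(2) by (simp add: insert_absorb)
  ultimately show ?thesis by (simp add: cube_slice_def top_face_def cong: conj_cong)
qed

lemma top_closed_cube_slice:
  assumes "I \<inter> J = {}" "top_closed J S"
  shows "top_closed J (cube_slice I J z S)"
  unfolding top_closed_def
proof (intro ballI)
  fix x j assume x: "x \<in> cube_slice I J z S" and j: "j \<in> J"
  have "merge I J (z, x(j := 1)) = (merge I J (z, x))(j := 1)"
    using assms(1) j by (auto simp: merge_def fun_eq_iff)
  with x j assms(2) show "x(j := 1) \<in> cube_slice I J z S"
    by (auto simp: cube_slice_def top_closed_def PiE_iff extensional_def)
qed

lemma cube_slice_subset_SIM_corner: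
  assumes "I \<inter> J = {}" "S \<subseteq> SIM_corner N \<alpha> J"
  shows "cube_slice I J z S \<subseteq> SIM_corner N \<alpha> J"
proof
  fix x assume "x \<in> cube_slice I J z S"
  then have merge: "merge I J (z, x) \<in> SIM_corner N \<alpha> J"
    using assms(2) by (auto simp: cube_slice_def)
  have "N * (\<Sum>i\<in>L. 1 - x i) \<le> (\<Sum>i\<in>{card J - card L + 1..card J}. \<alpha> i)" if L: "L \<subseteq> J" for L
  proof -
    have "(\<Sum>i\<in>L. 1 - x i) = (\<Sum>i\<in>L. 1 - merge I J (z, x) i)"
      using L assms(1) by (intro sum.cong) (auto simp: merge_def)
    also have "N * \<dots> \<le> (\<Sum>i\<in>{card J - card L + 1..card J}. \<alpha> i)"
      using merge L by (simp add: SIM_corner_def)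
    finally show ?thesis .
  qed
  then show "x \<in> SIM_corner N \<alpha> J" by (simp add: SIM_corner_def)
qed

lemma
  assumes IJ: "finite I" "finite J" "I \<inter> J = {}" and j: "j \<in> J" and S: "closed S"
  shows measurable_emeasure_top_face_slice:
      "(\<lambda>z. emeasure (cubeM (J - {j})) (top_face J j (cube_slice I J z S)))
          \<in> borel_measurable (cubeM I)"
    and emeasure_top_face_slice:
      "emeasure (cubeM (I \<union> J - {j})) (top_face (I \<union> J) j S) =
        (\<integral>\<^sup>+ z. emeasure (cubeM (J - {j})) (top_face J j (cube_slice I J z S)) \<partial>cubeM I)"
proof -
  have union_diff: "I \<union> (J - {j}) = I \<union> J - {j}" using IJ(3) j by auto
  have disj: "finite (J - {j})" "I \<inter> (J - {j}) = {}" using IJ by auto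
  have face: "top_face (I \<union> J) j S \<in> sets (cubeM (I \<union> (J - {j})))"
    using sets_top_face[OF S] by (simp add: union_diff)
  note slice_eq =
    arg_cong[OF cube_slice_top_face[OF IJ(3) j, of _ S], of _ "emeasure (cubeM (J - {j}))"]
  show "(\<lambda>z. emeasure (cubeM (J - {j})) (top_face J j (cube_slice I J z S)))
      \<in> borel_measurable (cubeM I)"
    using measurable_emeasure_cube_slice[OF IJ(1) disj face]
    by (rule measurable_cong[THEN iffD1, OF slice_eq, rotated])
  show "emeasure (cubeM (I \<union> J - {j})) (top_face (I \<union> J) j S) =
      (\<integral>\<^sup>+ z. emeasure (cubeM (J - {j})) (top_face J j (cube_slice I J z S)) \<partial>cubeM I)"
    using emeasure_cubeM_slice[OF IJ(1) disj face] nn_integral_cong[OF slice_eq]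
    by (simp add: union_diff)
qed

lemma emeasure_le_sum_top_faces_merge:
  assumes N: "0 < N" and IJ: "finite I" "finite J" "I \<inter> J = {}" "J \<noteq> {}"
    and S: "closed S" "S \<subseteq> PiE (I \<union> J) (\<lambda>_. {0..1})" "top_closed J S" "S \<subseteq> SIM_corner N \<alpha> J"
    and free: "deficiency_free 1 (card J) (SIM_body (card J) \<alpha>)"
  shows "ennreal N * emeasure (cubeM (I \<union> J)) S \<le>
    (\<Sum>j\<in>J. emeasure (cubeM (I \<union> J - {j})) (top_face (I \<union> J) j S))"
proof -
  let ?slice = "\<lambda>z. cube_slice I J z S"
  have slice_bound: "ennreal N * emeasure (cubeM J) (?slice z) \<le>
      (\<Sum>j\<in>J. emeasure (cubeM (J - {j})) (top_face J j (?slice z)))" for z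
  proof (rule emeasure_le_sum_top_faces[OF N IJ(2,4) _ _ _ _ free])
    show "?slice z \<subseteq> PiE J (\<lambda>_. {0..1})" by (auto simp: cube_slice_def)
  qed (intro closed_cube_slice top_closed_cube_slice cube_slice_subset_SIM_corner IJ S)+
  have "ennreal N * emeasure (cubeM (I \<union> J)) S =
      (\<integral>\<^sup>+ z. ennreal N * emeasure (cubeM J) (?slice z) \<partial>cubeM I)"
    using measurable_emeasure_cube_slice[OF IJ(1-3) sets_cubeM_closed[OF S(1,2)]]
    by (simp add: emeasure_cubeM_slice[OF IJ(1-3) sets_cubeM_closed[OF S(1,2)]] nn_integral_cmult)
  also have "\<dots> \<le> (\<integral>\<^sup>+ z. (\<Sum>j\<in>J. emeasure (cubeM (J - {j})) (top_face J j (?slice z))) \<partial>cubeM I)"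
    by (intro nn_integral_mono slice_bound)
  also have "\<dots> = (\<Sum>j\<in>J. emeasure (cubeM (I \<union> J - {j})) (top_face (I \<union> J) j S))"
    by (simp add: nn_integral_sum measurable_emeasure_top_face_slice[OF IJ(1-3) _ S(1)]
        emeasure_top_face_slice[OF IJ(1-3) _ S(1)])
  finally show ?thesis .
qed

section \<open>Demand regions of a bundle pricing\<close>

definition surplus :: "(nat \<Rightarrow> real) \<Rightarrow> (nat \<Rightarrow> real) \<Rightarrow> nat set \<Rightarrow> real" where
  "surplus q x J = (\<Sum>j\<in>J. x j) - q (card J)"

definition demand_region :: "nat \<Rightarrow> (nat \<Rightarrow> real) \<Rightarrow> nat set \<Rightarrow> (nat \<Rightarrow> real) set" where
  "demand_region m q J = {x \<in> cube m. \<forall>L. L \<subseteq> {..<m} \<longrightarrow> surplus q x L \<le> surplus q x J}"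

definition no_sale_region :: "nat \<Rightarrow> (nat \<Rightarrow> real) \<Rightarrow> (nat \<Rightarrow> real) set" where
  "no_sale_region m q = {x \<in> cube m. \<forall>J. J \<subseteq> {..<m} \<and> J \<noteq> {} \<longrightarrow> surplus q x J < 0}"

lemma cube_fun_upd: "x \<in> cube m \<Longrightarrow> j < m \<Longrightarrow> 0 \<le> t \<Longrightarrow> t \<le> 1 \<Longrightarrow> x(j := t) \<in> cube m"
  by (auto simp: cube_def PiE_iff extensional_def)

lemma continuous_on_surplus: "continuous_on UNIV (\<lambda>x. surplus q x J)"
  unfolding surplus_def by (intro continuous_intros continuous_on_product_coordinates)

lemma surplus_fun_upd:
  assumes "finite J"
  shows "surplus q (x(j := t)) J = surplus q x J + (if j \<in> J then t - x j else 0)"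
proof -
  have "(\<Sum>k\<in>J. (x(j := t)) k) = (\<Sum>k\<in>J. x k + (if k = j then t - x j else 0))"
    by (intro sum.cong) auto
  then show ?thesis using assms by (simp add: surplus_def sum.distrib)
qed

lemma closed_demand_region: "closed (demand_region m q J)"
proof -
  have "demand_region m q J = cube m \<inter> (\<Inter>L\<in>Pow {..<m}. {x. surplus q x L \<le> surplus q x J})"
    by (auto simp: demand_region_def)
  also have "closed \<dots>"
    unfolding cube_def
    by (intro closed_Int closed_PiE_Icc closed_INT ballI closed_Collect_le continuous_on_surplus)
  finally show ?thesis .
qed

lemma sets_no_sale_region: "no_sale_region m q \<in> sets (cubeM {..<m})"
proof -
  have "open (\<Inter>J\<in>Pow {..<m} - {{}}. {x. surplus q x J < 0})" (is "open ?U")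
    by (intro open_INT ballI open_Collect_less continuous_on_surplus continuous_on_const) auto
  then have "{x \<in> space (cubeM {..<m}). x \<in> ?U} \<in> sets (cubeM {..<m})"
    by (intro sets_cubeM_borel borel_open)
  also have "{x \<in> space (cubeM {..<m}). x \<in> ?U} = no_sale_region m q"
    by (auto simp: no_sale_region_def space_cubeM_lessThan)
  finally show ?thesis .
qed

lemma sets_sale_region: "cube m - no_sale_region m q \<in> sets (cubeM {..<m})"
  using sets.compl_sets[OF sets_no_sale_region] by (simp add: space_cubeM_lessThan)

lemma demand_region_fun_upd:
  assumes x: "x \<in> demand_region m q J" and J: "J \<subseteq> {..<m}" "j \<in> J"
  shows "x(j := 1) \<in> demand_region m q J"
proof -
  have cube: "x \<in> cube m" using x by (simp add: demand_region_def)
  then have "x(j := 1) \<in> cube m" "x j \<le> 1"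
    using J cube_fun_upd[OF cube, of j 1] by (auto simp: cube_def)
  moreover have "surplus q (x(j := 1)) L \<le> surplus q (x(j := 1)) J" if L: "L \<subseteq> {..<m}" for L
  proof -
    have "finite J" "finite L" using J L finite_subset by blast+
    moreover have "surplus q x L \<le> surplus q x J" using x L by (simp add: demand_region_def)
    ultimately show ?thesis using J(2) \<open>x j \<le> 1\<close> by (simp add: surplus_fun_upd)
  qed
  ultimately show ?thesis by (simp add: demand_region_def)
qed

lemma demand_region_subset_SIM_corner:
  assumes N: "0 < N" and \<alpha>: "\<And>r. 1 \<le> r \<Longrightarrow> \<alpha> r = N * (1 - (q r - q (r - 1)))"
    and J: "J \<subseteq> {..<m}"
  shows "demand_region m q J \<subseteq> SIM_corner N \<alpha> J"
proof
  fix x assume x: "x \<in> demand_region m q J"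
  define \<mu> where "\<mu> r = N * (real r - q r)" for r
  have "N * (\<Sum>i\<in>L. 1 - x i) \<le> (\<Sum>i\<in>{card J - card L + 1..card J}. \<alpha> i)" if L: "L \<subseteq> J" for L
  proof -
    define r where "r = card J"
    define s where "s = card J - card L"
    have fin: "finite J" "finite L" using J L by (meson finite_lessThan finite_subset)+
    have s: "s \<le> r" "card (J - L) = s" "card L = r - s"
      using fin L by (simp_all add: r_def s_def card_Diff_subset card_mono)
    have "J - L \<subseteq> {..<m}" using J by blast
    with x have "surplus q x (J - L) \<le> surplus q x J" by (simp add: demand_region_def)
    then have "q r - q s \<le> (\<Sum>i\<in>L. x i)"
      using sum.subset_diff[OF L fin(1), of x] s by (simp add: surplus_def r_def)
    then have "N * (\<Sum>i\<in>L. 1 - x i) \<le> N * (real (r - s) - (q r - q s))"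
      using N s by (intro mult_left_mono) (simp_all add: sum_subtractf)
    also have "\<dots> = \<mu> r - \<mu> s"
      using s by (simp add: \<mu>_def algebra_simps of_nat_diff)
    also have "\<dots> = (\<Sum>i\<in>{Suc s..r}. \<mu> i - \<mu> (i - 1))"
      using sum_telescope''[OF s(1), of \<mu>] by simp
    also have "\<dots> = (\<Sum>i\<in>{Suc s..r}. \<alpha> i)"
      by (intro sum.cong) (auto simp: \<alpha> \<mu>_def algebra_simps of_nat_diff)
    finally show ?thesis by (simp add: r_def s_def)
  qed
  then show "x \<in> SIM_corner N \<alpha> J" by (simp add: SIM_corner_def)
qed

lemma demand_region_nonempty_bundle:
  assumes q0: "q 0 = 0" and x: "x \<in> cube m" "x \<notin> no_sale_region m q"
  obtains J where "J \<subseteq> {..<m}" "J \<noteq> {}" "x \<in> demand_region m q J"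
proof -
  define bundles where "bundles = Pow {..<m} - {{}}"
  obtain K where K: "K \<in> bundles" "0 \<le> surplus q x K"
    using x unfolding no_sale_region_def bundles_def by (auto simp: not_less)
  have "finite bundles" by (simp add: bundles_def)
  then obtain J where J: "J \<in> bundles" "\<And>L. L \<in> bundles \<Longrightarrow> surplus q x L \<le> surplus q x J"
    using K(1) obtains_MAX[of bundles "surplus q x"] Max_ge[of "surplus q x ` bundles"]
    by (metis empty_iff finite_imageI imageI)
  have "surplus q x L \<le> surplus q x J" if L: "L \<subseteq> {..<m}" for L
  proof (cases "L = {}")
    case True
    then have "surplus q x L = 0" by (simp add: surplus_def q0)
    also have "0 \<le> surplus q x K" by (rule K)
    also have "\<dots> \<le> surplus q x J" by (rule J(2)[OF K(1)])
    finally show ?thesis .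
  qed (use J L in \<open>simp add: bundles_def\<close>)
  with J(1) x(1) that[of J] show thesis by (auto simp: demand_region_def bundles_def)
qed

lemma AE_cubeM_hyperplane:
  assumes I: "finite I" "i \<in> I" and c: "c i \<noteq> 0"
  shows "AE x in cubeM I. (\<Sum>k\<in>I. c k * x k) \<noteq> b"
proof -
  define H where "H = {x \<in> space (cubeM I). (\<Sum>k\<in>I. c k * x k) = b}"
  have "closed {x. (\<Sum>k\<in>I. c k * x k) = b}"
    by (intro closed_Collect_eq continuous_intros continuous_on_product_coordinates)
  from sets_cubeM_borel[OF borel_closed[OF this], of I] have H: "H \<in> sets (cubeM I)"
    by (simp add: H_def)
  have line: "(\<integral>\<^sup>+ y. indicator H (x(i := y)) \<partial>unit_lborel) = 0" for x
  proof -
    define t where "t = (b - (\<Sum>k\<in>I - {i}. c k * x k)) / c i"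
    have hit: "y = t" if "x(i := y) \<in> H" for y
    proof -
      have "(\<Sum>k\<in>I. c k * (x(i := y)) k) = c i * y + (\<Sum>k\<in>I - {i}. c k * x k)"
        using I by (simp add: sum.remove cong: sum.cong_simp)
      then show ?thesis using that c by (simp add: H_def t_def field_simps)
    qed
    have single: "indicator H (x(i := y)) * indicator {0..1} y \<le> (indicator {t} y :: ennreal)" for y
      by (cases "x(i := y) \<in> H") (auto dest: hit simp: indicator_def)
    have "(\<integral>\<^sup>+ y. indicator H (x(i := y)) \<partial>unit_lborel) =
        (\<integral>\<^sup>+ y. indicator H (x(i := y)) * indicator {0..1} y \<partial>lborel)"
      by (rule nn_integral_restrict_space) simp
    also have "\<dots> \<le> (\<integral>\<^sup>+ y. indicator {t} y \<partial>lborel)"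
      by (intro nn_integral_mono single)
    finally show ?thesis by simp
  qed
  have "emeasure (cubeM I) H = (\<integral>\<^sup>+ x. indicator H x \<partial>cubeM (insert i (I - {i})))"
    using H I by (simp add: insert_absorb)
  also have "\<dots> = (\<integral>\<^sup>+ x. (\<integral>\<^sup>+ y. indicator H (x(i := y)) \<partial>unit_lborel) \<partial>cubeM (I - {i}))"
    using H I by (intro cube.product_nn_integral_insert) (auto simp: insert_absorb)
  finally have "H \<in> null_sets (cubeM I)" using H by (simp add: null_sets_def line)
  from AE_not_in[OF this] AE_space show ?thesis by eventually_elim (simp add: H_def)
qed

lemma AE_sum_diff_neq:
  assumes I: "finite I" and JL: "J \<subseteq> I" "L \<subseteq> I" "J \<noteq> L"
  shows "AE x in cubeM I. (\<Sum>k\<in>J. x k) - (\<Sum>k\<in>L. x k) \<noteq> b"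
proof -
  have sum_eq: "(\<Sum>k\<in>K. x k) = (\<Sum>k\<in>I. indicator K k * x k)" if "K \<subseteq> I" for K and x :: "nat \<Rightarrow> real"
    using that I by (intro sum.mono_neutral_cong_left) auto
  obtain i where "i \<in> I" "i \<in> J \<longleftrightarrow> i \<notin> L"
    using JL by blast
  then have "i \<in> I" "indicator J i - indicator L i \<noteq> (0 :: real)"
    by (auto simp: indicator_def)
  from AE_cubeM_hyperplane[where c = "\<lambda>k. indicator J k - indicator L k", OF I this, of b]
  show ?thesis
    by (simp add: sum_eq[OF JL(1)] sum_eq[OF JL(2)] left_diff_distrib sum_subtractf)
qed

lemma surplus_eq_if_demanded:
  assumes "J \<subseteq> {..<m}" "L \<subseteq> {..<m}" "x \<in> demand_region m q J" "x \<in> demand_region m q L"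
  shows "surplus q x J = surplus q x L"
  using assms by (auto simp: demand_region_def intro!: antisym)

lemma AE_demand_region_unique:
  "AE x in cubeM {..<m}. \<forall>J\<in>Pow {..<m}. \<forall>L\<in>Pow {..<m}.
    x \<in> demand_region m q J \<longrightarrow> x \<in> demand_region m q L \<longrightarrow> J = L"
proof (intro AE_finite_allI)
  fix J L assume JL: "J \<in> Pow {..<m}" "L \<in> Pow {..<m}"
  show "AE x in cubeM {..<m}. x \<in> demand_region m q J \<longrightarrow> x \<in> demand_region m q L \<longrightarrow> J = L"
  proof (cases "J = L")
    case False
    then have "AE x in cubeM {..<m}. (\<Sum>k\<in>J. x k) - (\<Sum>k\<in>L. x k) \<noteq> q (card J) - q (card L)"
      using JL by (intro AE_sum_diff_neq) auto
    then show ?thesis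
    proof eventually_elim
      case (elim x)
      with JL surplus_eq_if_demanded[of J m L x q] show ?case by (auto simp: surplus_def)
    qed
  qed simp
qed simp_all

lemma AE_top_face_demand_region_unique:
  "AE x in cubeM ({..<m} - {j}). \<forall>J\<in>{J. J \<subseteq> {..<m} \<and> j \<in> J}. \<forall>L\<in>{L. L \<subseteq> {..<m} \<and> j \<in> L}.
    x(j := 1) \<in> demand_region m q J \<longrightarrow> x(j := 1) \<in> demand_region m q L \<longrightarrow> J = L"
proof (intro AE_finite_allI)
  fix J L assume JL: "J \<in> {J. J \<subseteq> {..<m} \<and> j \<in> J}" "L \<in> {L. L \<subseteq> {..<m} \<and> j \<in> L}"
  have face_sum: "surplus q (x(j := 1)) K = (\<Sum>k\<in>K - {j}. x k) + 1 - q (card K)"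
    if "K \<subseteq> {..<m}" "j \<in> K" for K x
    using that finite_subset[OF that(1)]
    by (simp add: surplus_fun_upd) (simp add: surplus_def sum.remove)
  show "AE x in cubeM ({..<m} - {j}).
      x(j := 1) \<in> demand_region m q J \<longrightarrow> x(j := 1) \<in> demand_region m q L \<longrightarrow> J = L"
  proof (cases "J = L")
    case False
    then have "J - {j} \<noteq> L - {j}" using JL by blast
    then have "AE x in cubeM ({..<m} - {j}).
        (\<Sum>k\<in>J - {j}. x k) - (\<Sum>k\<in>L - {j}. x k) \<noteq> q (card J) - q (card L)"
      using JL by (intro AE_sum_diff_neq) auto
    then show ?thesis
    proof eventually_elim
      case (elim x)
      with JL surplus_eq_if_demanded[of J m L "x(j := 1)" q] show ?case by (auto simp: face_sum)
    qed
  qed simp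
qed simp_all

section \<open>Comparing an integral over the cube with its faces\<close>

lemma sum_indicator_mult_le:
  assumes A: "finite A" and unique: "\<And>i j. i \<in> A \<Longrightarrow> j \<in> A \<Longrightarrow> y \<in> U i \<Longrightarrow> y \<in> U j \<Longrightarrow> i = j"
  shows "(\<Sum>i\<in>A. ennreal (indicator (U i) y * c)) \<le> ennreal c"
proof (cases "\<exists>i\<in>A. y \<in> U i")
  case True
  then obtain i where i: "i \<in> A" "y \<in> U i" by blast
  have "(\<Sum>j\<in>A. ennreal (indicator (U j) y * c)) = (\<Sum>j\<in>{i}. ennreal (indicator (U j) y * c))"
    using A i unique by (intro sum.mono_neutral_right) (auto simp: indicator_def)
  with i show ?thesis by simp
next
  case False
  then have "(\<Sum>i\<in>A. ennreal (indicator (U i) y * c)) = 0"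
    by (intro sum.neutral) auto
  then show ?thesis by simp
qed

locale deficiency_free_prices =
  fixes m :: nat and N :: real and q \<alpha> :: "nat \<Rightarrow> real"
  assumes N_pos: "0 < N" and price_0: "q 0 = 0"
    and SIM_weight: "\<And>r. 1 \<le> r \<Longrightarrow> \<alpha> r = N * (1 - (q r - q (r - 1)))"
    and deficiency_free: "\<And>J. J \<subseteq> {..<m} \<Longrightarrow> J \<noteq> {} \<Longrightarrow> demand_region m q J \<noteq> {} \<Longrightarrow>
      deficiency_free 1 (card J) (SIM_body (card J) \<alpha>)"
begin

definition rises_with_demand :: "((nat \<Rightarrow> real) \<Rightarrow> real) \<Rightarrow> bool" where
  "rises_with_demand w \<longleftrightarrow>
    (\<forall>J x j. J \<subseteq> {..<m} \<and> x \<in> demand_region m q J \<and> j \<in> J \<longrightarrow> w x \<le> w (x(j := 1)))"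

lemma emeasure_superlevel_le_sum_top_faces:
  assumes J: "J \<subseteq> {..<m}" "J \<noteq> {}" and g: "continuous_on UNIV g" "rises_with_demand g"
  shows "ennreal N * emeasure (cubeM {..<m}) {x \<in> demand_region m q J. t \<le> g x} \<le>
    (\<Sum>j\<in>J. emeasure (cubeM ({..<m} - {j})) (top_face {..<m} j {x \<in> demand_region m q J. t \<le> g x}))"
    (is "_ * emeasure _ ?S \<le> _")
proof (cases "demand_region m q J = {}")
  case False
  have "closed {x. t \<le> g x}"
    by (intro closed_Collect_le continuous_on_const g)
  then have closed: "closed ?S"
    unfolding Collect_conj_eq using closed_demand_region by (intro closed_Int) auto
  have cube: "?S \<subseteq> PiE {..<m} (\<lambda>_. {0..1})"
    by (auto simp: demand_region_def cube_def)
  have top: "top_closed J ?S"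
    unfolding top_closed_def
  proof (intro ballI)
    fix x j assume x: "x \<in> ?S" and j: "j \<in> J"
    then have "g x \<le> g (x(j := 1))" using g(2) J(1) unfolding rises_with_demand_def by blast
    with x j J(1) demand_region_fun_upd[of x m q J j] show "x(j := 1) \<in> ?S" by simp
  qed
  have SIM: "?S \<subseteq> SIM_corner N \<alpha> J"
    using demand_region_subset_SIM_corner[where q = q, OF N_pos _ J(1)] SIM_weight by blast
  have "finite J" "({..<m} - J) \<union> J = {..<m}" using J(1) finite_subset by auto
  then show ?thesis
    using emeasure_le_sum_top_faces_merge[OF N_pos _ _ _ J(2) closed _ top SIM
        deficiency_free[OF J False], of "{..<m} - J"] cube by auto
qed (simp add: top_face_def)

lemma nn_integral_demand_region_le_sum_faces:
  assumes J: "J \<subseteq> {..<m}" "J \<noteq> {}" and g: "continuous_on UNIV g" "rises_with_demand g"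
  shows "ennreal N * (\<integral>\<^sup>+ x. ennreal (indicator (demand_region m q J) x * g x) \<partial>cubeM {..<m}) \<le>
    (\<Sum>j\<in>J. \<integral>\<^sup>+ x. ennreal (indicator (demand_region m q J) (x(j := 1)) * g (x(j := 1)))
      \<partial>cubeM ({..<m} - {j}))"
proof -
  define f where "f x = indicator (demand_region m q J) x * g x" for x
  have f: "f \<in> borel_measurable borel"
    unfolding f_def
    using borel_measurable_continuous_onI[OF g(1)] borel_closed[OF closed_demand_region]
    by measurable
  have level: "t \<le> f x \<longleftrightarrow> x \<in> {x \<in> demand_region m q J. t \<le> g x}" if "0 < t" for t x
    using that by (auto simp: f_def indicator_def)
  have "{x \<in> space (cubeM {..<m}). x \<in> {x \<in> demand_region m q J. t \<le> g x}} =
      {x \<in> demand_region m q J. t \<le> g x}" for t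
    by (auto simp: space_cubeM_lessThan demand_region_def)
  moreover have
    "{x \<in> space (cubeM ({..<m} - {j})). x(j := 1) \<in> {x \<in> demand_region m q J. t \<le> g x}} =
      top_face {..<m} j {x \<in> demand_region m q J. t \<le> g x}" for j t
    by (simp add: top_face_def space_cubeM)
  ultimately have "ennreal N * emeasure (cubeM {..<m}) {x \<in> space (cubeM {..<m}). t \<le> f x} \<le>
      (\<Sum>j\<in>J. emeasure (cubeM ({..<m} - {j})) {x \<in> space (cubeM ({..<m} - {j})). t \<le> f (x(j := 1))})"
    if "0 < t" for t
    using emeasure_superlevel_le_sum_top_faces[OF J g, of t] by (simp only: level[OF that])
  then have "ennreal N * (\<integral>\<^sup>+ x. ennreal (f x) \<partial>cubeM {..<m}) \<le>
      (\<Sum>j\<in>J. \<integral>\<^sup>+ x. ennreal (f (x(j := 1))) \<partial>cubeM ({..<m} - {j}))"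
    by (intro nn_integral_le_sum_superlevel borel_measurable_cubeM[OF f]
        borel_measurable_cubeM_fun_upd[OF f] cube.sigma_finite) auto
  then show ?thesis by (simp add: f_def)
qed

lemma indicator_sale_le_sum_demand_regions:
  assumes x: "x \<in> cube m"
  shows "ennreal (indicator (cube m - no_sale_region m q) x * c) \<le>
    (\<Sum>J\<in>Pow {..<m} - {{}}. ennreal (indicator (demand_region m q J) x * c))"
proof (cases "x \<in> no_sale_region m q")
  case False
  obtain J where J: "J \<subseteq> {..<m}" "J \<noteq> {}" "x \<in> demand_region m q J"
    by (rule demand_region_nonempty_bundle[where q = q, OF price_0 x False])
  have "ennreal (indicator (cube m - no_sale_region m q) x * c) =
      ennreal (indicator (demand_region m q J) x * c)"
    using x False J(3) by simp
  also have "\<dots> \<le> (\<Sum>J\<in>Pow {..<m} - {{}}. ennreal (indicator (demand_region m q J) x * c))"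
    using J by (intro member_le_sum) auto
  finally show ?thesis .
qed simp

lemma nn_integral_sum_demand_regions_face_le:
  fixes g :: "(nat \<Rightarrow> real) \<Rightarrow> real"
  assumes g: "continuous_on UNIV g"
  shows "(\<Sum>J | J \<in> Pow {..<m} - {{}} \<and> j \<in> J.
      \<integral>\<^sup>+ x. ennreal (indicator (demand_region m q J) (x(j := 1)) * g (x(j := 1)))
        \<partial>cubeM ({..<m} - {j})) \<le>
    (\<integral>\<^sup>+ x. ennreal (g (x(j := 1))) \<partial>cubeM ({..<m} - {j}))"
    (is "(\<Sum>J | ?P J. \<integral>\<^sup>+ x. ?f J x \<partial>_) \<le> _")
proof -
  have "(\<lambda>x. ennreal (indicator (demand_region m q J) x * g x)) \<in> borel_measurable borel" for J
    using borel_measurable_continuous_onI[OF g] borel_closed[OF closed_demand_region] by measurable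
  then have "(\<Sum>J | ?P J. \<integral>\<^sup>+ x. ?f J x \<partial>cubeM ({..<m} - {j})) =
      (\<integral>\<^sup>+ x. (\<Sum>J | ?P J. ?f J x) \<partial>cubeM ({..<m} - {j}))"
    by (intro nn_integral_sum[symmetric] borel_measurable_cubeM_fun_upd)
  also have "\<dots> \<le> (\<integral>\<^sup>+ x. ennreal (g (x(j := 1))) \<partial>cubeM ({..<m} - {j}))"
  proof (rule nn_integral_mono_AE)
    show "AE x in cubeM ({..<m} - {j}). (\<Sum>J | ?P J. ?f J x) \<le> ennreal (g (x(j := 1)))"
      using AE_top_face_demand_region_unique[of m j q]
    proof eventually_elim
      case (elim x)
      then show ?case by (intro sum_indicator_mult_le) auto
    qed
  qed
  finally show ?thesis .
qed

lemma nn_integral_sale_le_sum_faces: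
  assumes g: "continuous_on UNIV g" "rises_with_demand g"
  shows "ennreal N *
      (\<integral>\<^sup>+ x. ennreal (indicator (cube m - no_sale_region m q) x * g x) \<partial>cubeM {..<m}) \<le>
    (\<Sum>j<m. \<integral>\<^sup>+ x. ennreal (g (x(j := 1))) \<partial>cubeM ({..<m} - {j}))"
proof -
  define f where "f J x = ennreal (indicator (demand_region m q J) x * g x)" for J x
  define bundles where "bundles = Pow {..<m} - {{}}"
  have f: "f J \<in> borel_measurable borel" for J
    unfolding f_def
    using borel_measurable_continuous_onI[OF g(1)] borel_closed[OF closed_demand_region]
    by measurable
  have "ennreal N *
        (\<integral>\<^sup>+ x. ennreal (indicator (cube m - no_sale_region m q) x * g x) \<partial>cubeM {..<m}) \<le>
      ennreal N * (\<integral>\<^sup>+ x. (\<Sum>J\<in>bundles. f J x) \<partial>cubeM {..<m})"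
    unfolding f_def bundles_def
    by (intro mult_left_mono nn_integral_mono indicator_sale_le_sum_demand_regions)
      (auto simp: space_cubeM_lessThan)
  also have "\<dots> = (\<Sum>J\<in>bundles. ennreal N * (\<integral>\<^sup>+ x. f J x \<partial>cubeM {..<m}))"
    using borel_measurable_cubeM[OF f] by (simp add: nn_integral_sum sum_distrib_left)
  also have "\<dots> \<le> (\<Sum>J\<in>bundles. \<Sum>j\<in>J. \<integral>\<^sup>+ x. f J (x(j := 1)) \<partial>cubeM ({..<m} - {j}))"
    unfolding f_def
    by (intro sum_mono nn_integral_demand_region_le_sum_faces g) (auto simp: bundles_def)
  also have "\<dots> = (\<Sum>J\<in>bundles. \<Sum>j | j \<in> {..<m} \<and> j \<in> J.
      \<integral>\<^sup>+ x. f J (x(j := 1)) \<partial>cubeM ({..<m} - {j}))"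
    by (intro sum.cong) (auto simp: bundles_def)
  also have "\<dots> = (\<Sum>j<m. \<Sum>J | J \<in> bundles \<and> j \<in> J.
      \<integral>\<^sup>+ x. f J (x(j := 1)) \<partial>cubeM ({..<m} - {j}))"
    by (intro sum.swap_restrict) (simp_all add: bundles_def)
  also have "\<dots> \<le> (\<Sum>j<m. \<integral>\<^sup>+ x. ennreal (g (x(j := 1))) \<partial>cubeM ({..<m} - {j}))"
    unfolding f_def bundles_def by (intro sum_mono nn_integral_sum_demand_regions_face_le g)
  finally show ?thesis .
qed

lemma integral_sale_le_sum_faces:
  assumes g: "continuous_on UNIV g" "rises_with_demand g" and nonneg: "\<And>x. x \<in> cube m \<Longrightarrow> 0 \<le> g x"
  shows "N * (\<integral>x. indicator (cube m - no_sale_region m q) x * g x \<partial>cubeM {..<m}) \<le>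
    (\<Sum>j<m. \<integral>x. g (x(j := 1)) \<partial>cubeM ({..<m} - {j}))"
proof -
  let ?sold = "\<lambda>x. indicator (cube m - no_sale_region m q) x * g x"
  have face_nonneg: "0 \<le> g (x(j := 1))" if "x \<in> space (cubeM ({..<m} - {j}))" "j < m" for x j
    using that PiE_fun_upd[of 1 "\<lambda>_. {0..1}" j x "{..<m} - {j}"]
    by (intro nonneg) (simp add: space_cubeM cube_def insert_absorb)
  have int_sold: "integrable (cubeM {..<m}) ?sold"
    using integrable_mult_indicator[OF sets_sale_region integrable_cubeM_continuous[OF g(1)]]
    by simp
  have "ennreal N * (\<integral>\<^sup>+ x. ennreal (?sold x) \<partial>cubeM {..<m}) \<le>
      (\<Sum>j<m. \<integral>\<^sup>+ x. ennreal (g (x(j := 1))) \<partial>cubeM ({..<m} - {j}))"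
    by (rule nn_integral_sale_le_sum_faces[OF g])
  also have "(\<integral>\<^sup>+ x. ennreal (?sold x) \<partial>cubeM {..<m}) = ennreal (integral\<^sup>L (cubeM {..<m}) ?sold)"
    using nonneg by (intro nn_integral_eq_integral int_sold AE_I2) (simp add: space_cubeM_lessThan)
  also have "(\<Sum>j<m. \<integral>\<^sup>+ x. ennreal (g (x(j := 1))) \<partial>cubeM ({..<m} - {j})) =
      (\<Sum>j<m. ennreal (\<integral>x. g (x(j := 1)) \<partial>cubeM ({..<m} - {j})))"
    by (intro sum.cong refl nn_integral_eq_integral integrable_cubeM_fun_upd[OF g(1)] AE_I2
        face_nonneg) auto
  also have "\<dots> = ennreal (\<Sum>j<m. \<integral>x. g (x(j := 1)) \<partial>cubeM ({..<m} - {j}))"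
    using face_nonneg by (intro sum_ennreal integral_nonneg_AE AE_I2) auto
  finally have "ennreal (N * integral\<^sup>L (cubeM {..<m}) ?sold) \<le>
      ennreal (\<Sum>j<m. \<integral>x. g (x(j := 1)) \<partial>cubeM ({..<m} - {j}))"
    using N_pos by (simp add: ennreal_mult')
  moreover have "0 \<le> (\<Sum>j<m. \<integral>x. g (x(j := 1)) \<partial>cubeM ({..<m} - {j}))"
    using face_nonneg by (intro sum_nonneg integral_nonneg_AE AE_I2) auto
  ultimately show ?thesis by (simp add: ennreal_le_iff)
qed

lemma integral_le_sum_faces:
  assumes w: "continuous_on UNIV w" "rises_with_demand w"
    and nonpos: "\<And>x. x \<in> no_sale_region m q \<Longrightarrow> w x \<le> 0"
    and no_sale: "measure (cubeM {..<m}) (no_sale_region m q) = 1 - real m / N"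
  shows "N * (\<integral>x. w x \<partial>cubeM {..<m}) \<le> (\<Sum>j<m. \<integral>x. w (x(j := 1)) \<partial>cubeM ({..<m} - {j}))"
proof -
  obtain B where B: "\<And>x. x \<in> cube m \<Longrightarrow> \<bar>w x\<bar> \<le> B"
    using bounded_on_cube[OF w(1), of "{..<m}"] unfolding cube_def by blast
  let ?sold = "\<lambda>x. indicator (cube m - no_sale_region m q) x :: real"
  have sale_prob: "measure (cubeM {..<m}) (cube m - no_sale_region m q) = real m / N"
    using unit_cube.prob_compl[OF sets_no_sale_region[of m q]] no_sale
    by (simp add: space_cubeM_lessThan)
  have int_w: "integrable (cubeM {..<m}) w" by (rule integrable_cubeM_continuous[OF w(1)])
  have int_sold: "integrable (cubeM {..<m}) (\<lambda>x. ?sold x * w x)"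
    using integrable_mult_indicator[OF sets_sale_region int_w] by simp
  have int_face: "integrable (cubeM ({..<m} - {j})) (\<lambda>x. w (x(j := 1)))" for j
    by (rule integrable_cubeM_fun_upd[OF w(1)])
  have "N * (\<integral>x. w x \<partial>cubeM {..<m}) \<le> N * (\<integral>x. ?sold x * w x \<partial>cubeM {..<m})"
  proof (intro mult_left_mono integral_mono int_w int_sold)
    fix x assume "x \<in> space (cubeM {..<m})"
    then show "w x \<le> ?sold x * w x"
      using nonpos by (cases "x \<in> no_sale_region m q") (auto simp: space_cubeM_lessThan)
  qed (use N_pos in simp)
  also have "\<dots> = N * (\<integral>x. ?sold x * w x + ?sold x * B \<partial>cubeM {..<m}) - real m * B"
    using int_sold sets_sale_region[of m q] N_pos
    by (simp add: unit_cube.emeasure_eq_measure sale_prob distrib_left)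
  also have "(\<integral>x. ?sold x * w x + ?sold x * B \<partial>cubeM {..<m}) =
      (\<integral>x. ?sold x * (w x + B) \<partial>cubeM {..<m})"
    by (simp add: distrib_left)
  also have "N * \<dots> \<le> (\<Sum>j<m. \<integral>x. w (x(j := 1)) + B \<partial>cubeM ({..<m} - {j}))"
  proof (rule integral_sale_le_sum_faces)
    show "continuous_on UNIV (\<lambda>x. w x + B)" by (intro continuous_intros w)
    show "rises_with_demand (\<lambda>x. w x + B)" using w(2) by (simp add: rises_with_demand_def)
    show "0 \<le> w x + B" if "x \<in> cube m" for x using B[OF that] by linarith
  qed
  also have "\<dots> = (\<Sum>j<m. \<integral>x. w (x(j := 1)) \<partial>cubeM ({..<m} - {j})) + real m * B"
    using int_face by (simp add: sum.distrib unit_cube.prob_space)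
  finally show ?thesis by simp
qed

end

section \<open>The revenue of an incentive compatible mechanism\<close>

lemma unit_integral_eq:
  fixes f :: "real \<Rightarrow> real"
  assumes "continuous_on {0..1} f"
  shows "(\<integral>t. f t \<partial>unit_lborel) = integral {0..1} f"
  using set_borel_integral_eq_integral(2)[OF borel_integrable_atLeastAtMost'[OF assms]]
  by (simp add: integral_restrict_space set_lebesgue_integral_def)

lemma has_real_derivative_unit_integral_scale:
  fixes h :: "real \<Rightarrow> real"
  assumes h: "continuous_on UNIV h"
  shows "((\<lambda>s. \<integral>t. h (s * t) \<partial>unit_lborel) has_real_derivative h 1 - (\<integral>t. h t \<partial>unit_lborel)) (at 1)"
proof -
  have cont: "continuous_on A h" for A using h continuous_on_subset by blast
  have scale: "(\<integral>t. h (s * t) \<partial>unit_lborel) = integral {0..s} h / s" if s: "0 < s" for s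
  proof -
    have "(\<lambda>t. t / s) ` {0..s} = {0..1}" using s image_divide_atLeastAtMost[of s 0 s] by simp
    moreover have "continuous_on {0..1} (\<lambda>t. h (s * t))"
      by (intro continuous_on_compose2[OF h] continuous_intros) auto
    ultimately show ?thesis
      using integral_stretch_real[of s 0 s h] s by (simp add: unit_integral_eq)
  qed
  have "((\<lambda>s. integral {0..s} h) has_real_derivative h 1) (at 1 within {0..2})"
    by (rule integral_has_real_derivative[OF cont]) simp
  then have "((\<lambda>s. integral {0..s} h) has_real_derivative h 1) (at 1)"
    by (simp add: at_within_Icc_at)
  then have "((\<lambda>s. integral {0..s} h / s) has_real_derivative h 1 - integral {0..1} h) (at 1)"
    by (auto intro!: derivative_eq_intros)
  then have "((\<lambda>s. \<integral>t. h (s * t) \<partial>unit_lborel) has_real_derivative h 1 - integral {0..1} h) (at 1)"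
    by (rule has_field_derivative_transform_within_open[where S = "{0<..}"]) (auto simp: scale)
  then show ?thesis by (simp add: unit_integral_eq[OF cont])
qed

lemma integral_cubeM_insert_rev:
  fixes f :: "(nat \<Rightarrow> real) \<Rightarrow> real"
  assumes I: "finite I" "j \<in> I" and f: "continuous_on UNIV f"
  shows "integral\<^sup>L (cubeM I) f = (\<integral>t. (\<integral>x. f (x(j := t)) \<partial>cubeM (I - {j})) \<partial>unit_lborel)"
proof -
  have ins: "insert j (I - {j}) = I" using I by auto
  interpret P: pair_prob_space "cubeM (I - {j})" unit_lborel ..
  obtain B where B: "\<And>x. x \<in> PiE I (\<lambda>_. {0..1}) \<Longrightarrow> \<bar>f x\<bar> \<le> B"
    using bounded_on_cube[OF f] by blast
  have "integrable (cubeM (I - {j}) \<Otimes>\<^sub>M unit_lborel) (\<lambda>(x, t). f (x(j := t)))"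
  proof (rule P.integrable_const_bound[where B = B])
    show "(\<lambda>(x, t). f (x(j := t))) \<in> borel_measurable (cubeM (I - {j}) \<Otimes>\<^sub>M unit_lborel)"
      using measurable_compose[OF measurable_add_dim[of j "I - {j}" "\<lambda>_. unit_lborel", unfolded ins]
          borel_measurable_cubeM[OF borel_measurable_continuous_onI[OF f]]]
      by (simp add: case_prod_unfold)
    show "AE p in cubeM (I - {j}) \<Otimes>\<^sub>M unit_lborel. norm (case p of (x, t) \<Rightarrow> f (x(j := t))) \<le> B"
    proof (rule AE_I2, clarify)
      fix x t assume "(x, t) \<in> space (cubeM (I - {j}) \<Otimes>\<^sub>M unit_lborel)"
      then have "x(j := t) \<in> PiE (insert j (I - {j})) (\<lambda>_. {0..1})"
        by (intro PiE_fun_upd) (auto simp: space_pair_measure space_cubeM space_restrict_space)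
      from B[OF this[unfolded ins]] show "norm (f (x(j := t))) \<le> B" by simp
    qed
  qed
  from P.Fubini_integral[OF this]
  have "(\<integral>t. (\<integral>x. f (x(j := t)) \<partial>cubeM (I - {j})) \<partial>unit_lborel) =
      (\<integral>x. (\<integral>t. f (x(j := t)) \<partial>unit_lborel) \<partial>cubeM (I - {j}))" .
  also have "\<dots> = integral\<^sup>L (cubeM (insert j (I - {j}))) f"
    using I integrable_cubeM_continuous[OF f]
    by (intro cube.product_integral_insert[symmetric]) auto
  finally show ?thesis unfolding ins ..
qed

lemma continuous_on_integral_fun_upd:
  fixes f :: "(nat \<Rightarrow> real) \<Rightarrow> real"
  assumes f: "continuous_on UNIV f"
  shows "continuous_on UNIV (\<lambda>t. \<integral>x. f (x(j := t)) \<partial>cubeM I)"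
proof (rule continuous_on_sequentiallyI)
  fix u :: "nat \<Rightarrow> real" and a assume u: "u \<longlonglongrightarrow> a"
  obtain R where R: "\<And>n. \<bar>u n\<bar> \<le> R"
    using convergent_imp_Bseq[of u] u by (auto simp: convergent_def Bseq_def)
  let ?S = "\<lambda>i. if i = j then {-R..R} else {0..1}"
  have "\<exists>B. \<forall>x\<in>PiE (insert j I) ?S. \<bar>f x\<bar> \<le> B"
    by (rule bounded_on_compact_PiE[OF f]) simp
  then obtain B where B: "\<And>x. x \<in> PiE (insert j I) ?S \<Longrightarrow> \<bar>f x\<bar> \<le> B" by metis
  have measurable: "(\<lambda>x. f (x(j := t))) \<in> borel_measurable (cubeM I)" for t
    by (rule borel_measurable_integrable[OF integrable_cubeM_fun_upd[OF f]])
  show "(\<lambda>n. \<integral>x. f (x(j := u n)) \<partial>cubeM I) \<longlonglongrightarrow> (\<integral>x. f (x(j := a)) \<partial>cubeM I)"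
  proof (rule integral_dominated_convergence[where w = "\<lambda>_. B"])
    show "AE x in cubeM I. (\<lambda>n. f (x(j := u n))) \<longlonglongrightarrow> f (x(j := a))"
    proof (rule AE_I2)
      fix x
      have "continuous_on UNIV (\<lambda>t. f (x(j := t)))"
        by (intro continuous_on_compose2[OF f] continuous_intros) auto
      from continuous_on_tendsto_compose[OF this u]
      show "(\<lambda>n. f (x(j := u n))) \<longlonglongrightarrow> f (x(j := a))" by simp
    qed
    show "AE x in cubeM I. norm (f (x(j := u n))) \<le> B" for n
    proof (rule AE_I2)
      fix x assume "x \<in> space (cubeM I)"
      then have "x(j := u n) \<in> PiE (insert j I) ?S"
        using R[of n] by (auto simp: space_cubeM PiE_iff extensional_def abs_le_iff minus_le_iff)
      then show "norm (f (x(j := u n))) \<le> B" using B by simp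
    qed
  qed (simp_all add: measurable)
qed

lemma has_real_derivative_integral_scale_coordinate:
  fixes f :: "(nat \<Rightarrow> real) \<Rightarrow> real"
  assumes I: "finite I" "j \<in> I" and f: "continuous_on UNIV f"
  shows "((\<lambda>s. \<integral>x. f (x(j := s * x j)) \<partial>cubeM I) has_real_derivative
    (\<integral>x. f (x(j := 1)) \<partial>cubeM (I - {j})) - integral\<^sup>L (cubeM I) f) (at 1)"
proof -
  define h where "h t = (\<integral>x. f (x(j := t)) \<partial>cubeM (I - {j}))" for t
  have "continuous_on UNIV (\<lambda>x. f (x(j := s * x j)))" for s
    by (intro continuous_on_compose_fun_upd[OF f] continuous_intros
        continuous_on_product_coordinates)
  then have "(\<integral>x. f (x(j := s * x j)) \<partial>cubeM I) = (\<integral>t. h (s * t) \<partial>unit_lborel)" for s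
    by (simp add: integral_cubeM_insert_rev[OF I] h_def)
  moreover have "integral\<^sup>L (cubeM I) f = (\<integral>t. h t \<partial>unit_lborel)"
    by (simp add: integral_cubeM_insert_rev[OF I f] h_def)
  moreover have "continuous_on UNIV h"
    unfolding h_def by (rule continuous_on_integral_fun_upd[OF f])
  ultimately show ?thesis
    using has_real_derivative_unit_integral_scale[of h] by (simp add: h_def)
qed

text \<open>
  Letting valuations range over the whole space keeps the subgradient inequality valid for all
  rescalings of a valuation in the cube.
\<close>

definition indirect_utility ::
    "nat \<Rightarrow> ((nat \<Rightarrow> real) \<Rightarrow> (nat \<Rightarrow> real)) \<Rightarrow> ((nat \<Rightarrow> real) \<Rightarrow> real) \<Rightarrow>
      (nat \<Rightarrow> real) \<Rightarrow> real" where
  "indirect_utility m a p x = (SUP y\<in>cube m. dotp m (a y) x - p y)"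

definition revenue_functional :: "nat \<Rightarrow> ((nat \<Rightarrow> real) \<Rightarrow> real) \<Rightarrow> real" where
  "revenue_functional m u = (\<Sum>j<m. \<integral>x. u (x(j := 1)) \<partial>cubeM ({..<m} - {j})) -
    (real m + 1) * (\<integral>x. u x \<partial>cubeM {..<m})"

lemma revenue_functional_diff:
  assumes "continuous_on UNIV u" "continuous_on UNIV v"
  shows "revenue_functional m (\<lambda>x. u x - v x) = revenue_functional m u - revenue_functional m v"
proof -
  have face: "(\<integral>x. u (x(j := 1)) - v (x(j := 1)) \<partial>cubeM I) =
      (\<integral>x. u (x(j := 1)) \<partial>cubeM I) - (\<integral>x. v (x(j := 1)) \<partial>cubeM I)" for I j
    by (rule Bochner_Integration.integral_diff[OF assms[THEN integrable_cubeM_fun_upd]])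
  have cube: "(\<integral>x. u x - v x \<partial>cubeM I) = (\<integral>x. u x \<partial>cubeM I) - (\<integral>x. v x \<partial>cubeM I)" for I
    by (rule Bochner_Integration.integral_diff[OF assms[THEN integrable_cubeM_continuous]])
  show ?thesis
    unfolding revenue_functional_def face cube sum_subtractf right_diff_distrib by linarith
qed

locale ic_mechanism =
  fixes m :: nat and a :: "(nat \<Rightarrow> real) \<Rightarrow> (nat \<Rightarrow> real)" and p :: "(nat \<Rightarrow> real) \<Rightarrow> real"
  assumes alloc: "is_alloc m a" and IC: "is_IC m a p"
begin

abbreviation U :: "(nat \<Rightarrow> real) \<Rightarrow> real" where
  "U \<equiv> indirect_utility m a p"

lemma dotp_alloc_Lipschitz:
  assumes "y \<in> cube m"
  shows "dotp m (a y) x \<le> dotp m (a y) z + (\<Sum>i<m. \<bar>x i - z i\<bar>)"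
proof -
  have "dotp m (a y) x - dotp m (a y) z = (\<Sum>i<m. a y i * (x i - z i))"
    by (simp add: dotp_def right_diff_distrib sum_subtractf)
  also have "\<dots> \<le> (\<Sum>i<m. \<bar>x i - z i\<bar>)"
  proof (rule sum_mono)
    fix i assume "i \<in> {..<m}"
    then have "\<bar>a y i\<bar> \<le> 1" using alloc assms by (auto simp: is_alloc_def)
    then have "\<bar>a y i * (x i - z i)\<bar> \<le> \<bar>x i - z i\<bar>"
      using mult_right_mono[of "\<bar>a y i\<bar>" 1 "\<bar>x i - z i\<bar>"] by (simp add: abs_mult)
    then show "a y i * (x i - z i) \<le> \<bar>x i - z i\<bar>" by (rule order_trans[OF abs_ge_self])
  qed
  finally show ?thesis by simp
qed

lemma report_utility_le:
  assumes y: "y \<in> cube m"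
  shows "dotp m (a y) x - p y \<le> U x"
  unfolding indirect_utility_def
proof (rule cSUP_upper[OF y])
  define z where "z = (\<lambda>i\<in>{..<m}. 0 :: real)"
  have z: "z \<in> cube m" by (simp add: z_def cube_def)
  show "bdd_above ((\<lambda>y. dotp m (a y) x - p y) ` cube m)"
  proof (rule bdd_aboveI2)
    fix y assume y: "y \<in> cube m"
    have "dotp m (a y) z - p y \<le> dotp m (a z) z - p z"
      using IC y z by (simp add: is_IC_def)
    with dotp_alloc_Lipschitz[OF y, of x z]
    show "dotp m (a y) x - p y \<le> dotp m (a z) z - p z + (\<Sum>i<m. \<bar>x i - z i\<bar>)" by linarith
  qed
qed

lemma indirect_utility_le:
  assumes "\<And>y. y \<in> cube m \<Longrightarrow> dotp m (a y) x - p y \<le> c"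
  shows "U x \<le> c"
proof -
  have "(\<lambda>i\<in>{..<m}. 0) \<in> cube m" by (simp add: cube_def)
  then show ?thesis unfolding indirect_utility_def using assms by (intro cSUP_least) auto
qed

lemma indirect_utility_eq:
  assumes x: "x \<in> cube m"
  shows "U x = dotp m (a x) x - p x"
  using IC x by (intro antisym indirect_utility_le report_utility_le) (auto simp: is_IC_def)

lemma indirect_utility_subgradient:
  assumes "x \<in> cube m"
  shows "dotp m (a x) y - dotp m (a x) x \<le> U y - U x"
  using report_utility_le[OF assms, of y] indirect_utility_eq[OF assms] by linarith

lemma indirect_utility_Lipschitz: "U x \<le> U z + (\<Sum>i<m. \<bar>x i - z i\<bar>)"
proof (rule indirect_utility_le)
  fix y assume y: "y \<in> cube m"
  from dotp_alloc_Lipschitz[OF y, of x z] report_utility_le[OF y, of z]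
  show "dotp m (a y) x - p y \<le> U z + (\<Sum>i<m. \<bar>x i - z i\<bar>)" by linarith
qed

lemma indirect_utility_fun_upd_le: "U (x(j := t)) \<le> U x + \<bar>t - x j\<bar>"
proof -
  have "(\<Sum>i<m. \<bar>(x(j := t)) i - x i\<bar>) = (\<Sum>i<m. if i = j then \<bar>t - x j\<bar> else 0)"
    by (intro sum.cong) auto
  also have "\<dots> \<le> \<bar>t - x j\<bar>" by simp
  finally show ?thesis using indirect_utility_Lipschitz[of "x(j := t)" x] by linarith
qed

lemma continuous_on_indirect_utility: "continuous_on UNIV U"
proof -
  have "(U \<longlongrightarrow> U x) (at x)" for x
  proof (subst Lim_null, rule Lim_null_comparison)
    have "\<bar>U z - U x\<bar> \<le> (\<Sum>i<m. \<bar>z i - x i\<bar>)" for z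
      using indirect_utility_Lipschitz[of z x] indirect_utility_Lipschitz[of x z]
      by (simp add: abs_minus_commute)
    then show "\<forall>\<^sub>F z in at x. norm (U z - U x) \<le> (\<Sum>i<m. \<bar>z i - x i\<bar>)" by simp
    have "((\<lambda>z. z i) \<longlongrightarrow> x i) (at x)" for i
      using continuous_on_product_coordinates[of i, unfolded continuous_on_def] by auto
    then have "((\<lambda>z. \<Sum>i<m. \<bar>z i - x i\<bar>) \<longlongrightarrow> (\<Sum>i<m. \<bar>x i - x i\<bar>)) (at x)"
      by (intro tendsto_intros)
    then show "((\<lambda>z. \<Sum>i<m. \<bar>z i - x i\<bar>) \<longlongrightarrow> 0) (at x)" by simp
  qed
  then show ?thesis by (simp add: continuous_on_def)
qed

lemma integrable_payment:
  assumes p: "p \<in> borel_measurable (completion (cubeM {..<m}))"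
  shows "integrable (completion (cubeM {..<m})) p"
proof -
  interpret completion: prob_space "completion (cubeM {..<m})"
    by (rule unit_cube.prob_space_completion)
  obtain B where B: "\<And>x. x \<in> cube m \<Longrightarrow> \<bar>U x\<bar> \<le> B"
    using bounded_on_cube[OF continuous_on_indirect_utility, of "{..<m}"]
    unfolding cube_def by blast
  have "norm (p x) \<le> real m + B" if x: "x \<in> cube m" for x
  proof -
    have "0 \<le> a x i * x i \<and> a x i * x i \<le> 1" if "i < m" for i
      using alloc x that by (auto simp: is_alloc_def cube_def PiE_iff mult_le_one)
    then have "0 \<le> dotp m (a x) x" "dotp m (a x) x \<le> real m"
      unfolding dotp_def using sum_mono[of "{..<m}" "\<lambda>i. a x i * x i" "\<lambda>_. 1"]
      by (auto intro: sum_nonneg)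
    with B[OF x] indirect_utility_eq[OF x] show ?thesis by auto
  qed
  then show ?thesis
    using p by (intro completion.integrable_const_bound[where B = "real m + B"] AE_I2)
      (auto simp: space_cubeM_lessThan)
qed

lemma payment_scale_bound:
  assumes x: "x \<in> cube m"
  shows "(p x + U x) * (s - 1) \<le> (\<Sum>j<m. U (x(j := s * x j)) - U x)"
proof -
  have "a x j * x j * (s - 1) \<le> U (x(j := s * x j)) - U x" if j: "j < m" for j
  proof -
    have "dotp m (a x) (x(j := s * x j)) =
        (\<Sum>i<m. a x i * x i + (if i = j then a x j * x j * (s - 1) else 0))"
      unfolding dotp_def by (intro sum.cong) (auto simp: algebra_simps)
    then have "dotp m (a x) (x(j := s * x j)) - dotp m (a x) x = a x j * x j * (s - 1)"
      using j by (simp add: sum.distrib dotp_def)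
    with indirect_utility_subgradient[OF x, of "x(j := s * x j)"] show ?thesis by simp
  qed
  then have "dotp m (a x) x * (s - 1) \<le> (\<Sum>j<m. U (x(j := s * x j)) - U x)"
    unfolding dotp_def sum_distrib_right by (intro sum_mono) simp
  then show ?thesis by (simp add: indirect_utility_eq[OF x])
qed

text \<open>
  The allocation need not be measurable, which is why the combination \<open>p x + U x = a x \<bullet> x\<close> is
  integrated as a whole.
\<close>

lemma payment_integral_scale_bound:
  assumes p: "p \<in> borel_measurable (completion (cubeM {..<m}))"
  shows "(revenue m p + (\<integral>x. U x \<partial>cubeM {..<m})) * (s - 1) \<le>
    (\<Sum>j<m. (\<integral>x. U (x(j := s * x j)) \<partial>cubeM {..<m}) - (\<integral>x. U x \<partial>cubeM {..<m}))"
proof -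
  let ?\<Delta> = "\<lambda>x. \<Sum>j<m. U (x(j := s * x j)) - U x"
  have cont: "continuous_on UNIV U" by (rule continuous_on_indirect_utility)
  have cont_scale: "continuous_on UNIV (\<lambda>x. U (x(j := s * x j)))" for j
    by (intro continuous_on_compose_fun_upd[OF cont] continuous_intros
        continuous_on_product_coordinates)
  have cont_\<Delta>: "continuous_on UNIV ?\<Delta>" by (intro continuous_intros cont cont_scale)
  have completion: "integrable (completion (cubeM {..<m})) f"
    "integral\<^sup>L (completion (cubeM {..<m})) f = integral\<^sup>L (cubeM {..<m}) f"
    if "continuous_on UNIV f" for f :: "(nat \<Rightarrow> real) \<Rightarrow> real"
    using integrable_cubeM_continuous[OF that]
    by (simp_all add: integrable_completion integral_completion borel_measurable_integrable)
  have "(revenue m p + (\<integral>x. U x \<partial>cubeM {..<m})) * (s - 1) =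
      (\<integral>x. (p x + U x) * (s - 1) \<partial>completion (cubeM {..<m}))"
    using integrable_payment[OF p] completion[OF cont] by (simp add: revenue_def unifM_def)
  also have "\<dots> \<le> integral\<^sup>L (completion (cubeM {..<m})) ?\<Delta>"
    using integrable_payment[OF p] completion(1)[OF cont] completion(1)[OF cont_\<Delta>]
      payment_scale_bound
    by (intro integral_mono integrable_mult_left Bochner_Integration.integrable_add)
      (auto simp: space_cubeM_lessThan)
  also have "\<dots> = (\<Sum>j<m. (\<integral>x. U (x(j := s * x j)) \<partial>cubeM {..<m}) - (\<integral>x. U x \<partial>cubeM {..<m}))"
    using integrable_cubeM_continuous[OF cont_scale] integrable_cubeM_continuous[OF cont]
    by (simp add: completion(2)[OF cont_\<Delta>])
  finally show ?thesis .
qed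

lemma revenue_eq_revenue_functional:
  assumes p: "p \<in> borel_measurable (completion (unifM m))"
  shows "revenue m p = revenue_functional m U"
proof -
  define I where "I = (\<integral>x. U x \<partial>cubeM {..<m})"
  define F where "F j = (\<integral>x. U (x(j := 1)) \<partial>cubeM ({..<m} - {j}))" for j
  define gap where "gap s = (\<Sum>j<m. (\<integral>x. U (x(j := s * x j)) \<partial>cubeM {..<m}) - I) -
    (revenue m p + I) * (s - 1)" for s
  have "((\<lambda>s. \<integral>x. U (x(j := s * x j)) \<partial>cubeM {..<m}) has_real_derivative F j - I) (at 1)"
      if "j < m" for j
    unfolding F_def I_def using that
    by (intro has_real_derivative_integral_scale_coordinate continuous_on_indirect_utility) auto
  then have "(gap has_real_derivative (\<Sum>j<m. F j - I) - (revenue m p + I)) (at 1)"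
    unfolding gap_def by (auto intro!: derivative_eq_intros)
  moreover have "gap 1 = 0"
    by (simp add: gap_def I_def)
  moreover have "0 \<le> gap s" for s
    using payment_integral_scale_bound[of s] p by (simp add: gap_def I_def unifM_def)
  ultimately have "(\<Sum>j<m. F j - I) - (revenue m p + I) = 0"
    by (intro DERIV_local_min[of gap _ 1 1]) auto
  then show ?thesis
    by (simp add: revenue_functional_def F_def I_def sum_subtractf algebra_simps)
qed

end

section \<open>SJA prices and the SJA mechanism\<close>

lemma sja_region_eq_demand_region: "sja_region m p J = demand_region m (norm_prices m p) J"
  by (simp add: sja_region_def demand_region_def surplus_def)

lemma sja_lambda_eq:
  assumes "p 0 = 0" "1 \<le> r"
  shows "sja_lambda m p r = (real m + 1) * (1 - (norm_prices m p r - norm_prices m p (r - 1)))"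
  using assms by (auto simp: sja_lambda_def sja_mu_def norm_prices_def of_nat_diff algebra_simps)

lemma surplus_le_surplus_norm_prices: "surplus p x J \<le> surplus (norm_prices m p) x J"
  by (simp add: surplus_def norm_prices_def)

lemma surplus_norm_prices_le:
  assumes x: "x \<in> cube m" and J: "J \<subseteq> {..<m}"
  shows "surplus (norm_prices m p) x J \<le> max (surplus p x J) (surplus p x {..<m})"
proof -
  have "(\<Sum>j\<in>J. x j) \<le> (\<Sum>j<m. x j)"
    using J x by (intro sum_mono2) (auto simp: cube_def PiE_iff)
  then show ?thesis by (auto simp: surplus_def norm_prices_def max_def)
qed

lemma no_sale_region_norm_prices: "no_sale_region m (norm_prices m p) = no_sale_region m p"
proof (intro set_eqI iffI)
  fix x assume "x \<in> no_sale_region m (norm_prices m p)"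
  then show "x \<in> no_sale_region m p"
    using surplus_le_surplus_norm_prices[of p x _ m] unfolding no_sale_region_def
    by (blast intro: le_less_trans)
next
  fix x assume x: "x \<in> no_sale_region m p"
  have "surplus (norm_prices m p) x J < 0" if J: "J \<subseteq> {..<m}" "J \<noteq> {}" for J
  proof -
    have "{..<m} \<noteq> {}" using J by blast
    then have "surplus p x J < 0" "surplus p x {..<m} < 0"
      using x J unfolding no_sale_region_def by blast+
    moreover have "x \<in> cube m" using x by (simp add: no_sale_region_def)
    ultimately show ?thesis using surplus_norm_prices_le[of x m J p] J(1) by linarith
  qed
  then show "x \<in> no_sale_region m (norm_prices m p)"
    using x by (simp add: no_sale_region_def)
qed

lemma measure_no_sale_region:
  assumes "1 \<le> m" "sja_prices m p"
  shows "measure (cubeM {..<m}) (no_sale_region m p) = 1 - real m / (real m + 1)"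
proof -
  have "no_sale_region m p =
      {x \<in> space (unifM m). \<forall>J. J \<subseteq> {..<m} \<and> J \<noteq> {} \<longrightarrow> (\<Sum>j\<in>J. x j) < p (card J)}"
    by (simp add: no_sale_region_def unifM_def space_cubeM_lessThan surplus_def)
  then show ?thesis
    using assms by (simp add: sja_prices_def sja_prob_def unifM_def)
qed

lemma dotp_bundle:
  assumes "J \<subseteq> {..<m}" "\<And>i. i < m \<Longrightarrow> b i = (if i \<in> J then 1 else 0)"
  shows "dotp m b x = (\<Sum>i\<in>J. x i)"
proof -
  have "dotp m b x = (\<Sum>i<m. if i \<in> J then x i else 0)"
    unfolding dotp_def using assms(2) by (intro sum.cong) auto
  with assms(1) show ?thesis by (simp add: sum.inter_restrict[symmetric] Int_absorb1)
qed

locale sja_mechanism =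
  fixes m :: nat and p :: "nat \<Rightarrow> real"
    and a :: "(nat \<Rightarrow> real) \<Rightarrow> (nat \<Rightarrow> real)" and pay :: "(nat \<Rightarrow> real) \<Rightarrow> real"
  assumes implements: "sja_implements m p a pay" and price_0: "p 0 = 0"
begin

lemma demanded_bundle:
  assumes "x \<in> cube m"
  obtains J where "J \<subseteq> {..<m}" "x \<in> demand_region m p J" "pay x = p (card J)"
    "\<forall>i<m. a x i = (if i \<in> J then 1 else 0)" "\<forall>z. dotp m (a x) z - pay x = surplus p z J"
proof -
  obtain J where J: "J \<subseteq> {..<m}" "\<And>L. L \<subseteq> {..<m} \<Longrightarrow> surplus p x L \<le> surplus p x J"
    "\<And>i. i < m \<Longrightarrow> a x i = (if i \<in> J then 1 else 0)" "pay x = p (card J)"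
    using implements assms unfolding sja_implements_def surplus_def by blast
  then show thesis
    using assms that[of J] by (simp add: demand_region_def surplus_def dotp_bundle)
qed

lemma sja_is_alloc: "is_alloc m a"
  unfolding is_alloc_def by (auto elim: demanded_bundle)

lemma sja_is_IC: "is_IC m a pay"
  unfolding is_IC_def
proof (intro ballI)
  fix x y assume x: "x \<in> cube m" and y: "y \<in> cube m"
  obtain J where J: "x \<in> demand_region m p J" "\<forall>z. dotp m (a x) z - pay x = surplus p z J"
    by (rule demanded_bundle[OF x])
  obtain L where L: "L \<subseteq> {..<m}" "\<forall>z. dotp m (a y) z - pay y = surplus p z L"
    by (rule demanded_bundle[OF y])
  show "dotp m (a y) x - pay y \<le> dotp m (a x) x - pay x"
    using J L by (simp add: demand_region_def)
qed

sublocale ic_mechanism m a pay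
  by standard (fact sja_is_alloc sja_is_IC)+

lemma indirect_utility_demand_region:
  assumes x: "x \<in> demand_region m p J" and J: "J \<subseteq> {..<m}"
  shows "U x = surplus p x J"
proof -
  have cube: "x \<in> cube m" using x by (simp add: demand_region_def)
  obtain L where "L \<subseteq> {..<m}" "x \<in> demand_region m p L" "\<forall>z. dotp m (a x) z - pay x = surplus p z L"
    by (rule demanded_bundle[OF cube])
  with surplus_eq_if_demanded[OF J _ x] show ?thesis by (simp add: indirect_utility_eq[OF cube])
qed

lemma surplus_le_indirect_utility:
  assumes x: "x \<in> cube m" and J: "J \<subseteq> {..<m}"
  shows "surplus p x J \<le> U x"
proof -
  obtain L where L: "L \<subseteq> {..<m}" "x \<in> demand_region m p L"
    by (rule demanded_bundle[OF x])
  then have "surplus p x J \<le> surplus p x L" using J by (simp add: demand_region_def)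
  also have "\<dots> = U x" by (rule indirect_utility_demand_region[OF L(2,1), symmetric])
  finally show ?thesis .
qed

lemma sja_is_IR: "is_IR m a pay"
  unfolding is_IR_def
proof
  fix x assume x: "x \<in> cube m"
  have "surplus p x {} = 0" by (simp add: surplus_def price_0)
  with surplus_le_indirect_utility[OF x, of "{}"]
  show "0 \<le> dotp m (a x) x - pay x" by (simp add: indirect_utility_eq[OF x])
qed

lemma borel_measurable_payment: "pay \<in> borel_measurable (completion (unifM m))"
proof -
  define price where
    "price x = (\<Sum>J\<in>Pow {..<m}. indicator (demand_region m p J) x * p (card J))" for x
  have "price \<in> borel_measurable borel"
    unfolding price_def using borel_closed[OF closed_demand_region] by measurable
  then have "price \<in> borel_measurable (cubeM {..<m})"
    by (rule borel_measurable_cubeM)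
  moreover have "AE x in cubeM {..<m}. pay x = price x"
    using AE_demand_region_unique[of m p] AE_space
  proof eventually_elim
    case (elim x)
    then have "x \<in> cube m" by (simp add: space_cubeM_lessThan)
    then obtain J where J: "J \<subseteq> {..<m}" "x \<in> demand_region m p J" "pay x = p (card J)"
      by (rule demanded_bundle)
    have "price x = (\<Sum>L\<in>{J}. indicator (demand_region m p L) x * p (card L))"
      unfolding price_def using elim(1) J
      by (intro sum.mono_neutral_right) (auto simp: indicator_def)
    with J show ?case by simp
  qed
  ultimately show ?thesis unfolding unifM_def by (rule borel_measurable_completion_AE)
qed

lemma indirect_utility_sja_region:
  assumes x: "x \<in> sja_region m p J" and J: "J \<subseteq> {..<m}"
  shows "U x = surplus (norm_prices m p) x J"
proof (rule antisym)
  have cube: "x \<in> cube m" using x by (simp add: sja_region_def)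
  obtain K where K: "K \<subseteq> {..<m}" "x \<in> demand_region m p K"
    by (rule demanded_bundle[OF cube])
  have "U x = surplus p x K" by (rule indirect_utility_demand_region[OF K(2,1)])
  also have "\<dots> \<le> surplus (norm_prices m p) x K" by (rule surplus_le_surplus_norm_prices)
  also have "\<dots> \<le> surplus (norm_prices m p) x J"
    using x K(1) by (simp add: sja_region_eq_demand_region demand_region_def)
  finally show "U x \<le> surplus (norm_prices m p) x J" .
  show "surplus (norm_prices m p) x J \<le> U x"
    using surplus_norm_prices_le[OF cube J, of p] surplus_le_indirect_utility[OF cube J]
      surplus_le_indirect_utility[OF cube subset_refl] by linarith
qed

lemma indirect_utility_sja_region_fun_upd:
  assumes x: "x \<in> sja_region m p J" and J: "J \<subseteq> {..<m}" "j \<in> J"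
  shows "U (x(j := 1)) = U x + (1 - x j)"
proof -
  have "x(j := 1) \<in> sja_region m p J"
    using demand_region_fun_upd x J unfolding sja_region_eq_demand_region by blast
  moreover have "finite J" using J(1) finite_subset by blast
  ultimately show ?thesis
    using J x by (simp add: indirect_utility_sja_region surplus_fun_upd)
qed

lemma indirect_utility_no_sale_region:
  assumes x: "x \<in> no_sale_region m p"
  shows "U x \<le> 0"
proof -
  have "x \<in> cube m" using x by (simp add: no_sale_region_def)
  then obtain J where J: "J \<subseteq> {..<m}" "x \<in> demand_region m p J" by (rule demanded_bundle)
  have "surplus p x J \<le> 0"
    using x J(1) by (cases "J = {}") (auto simp: no_sale_region_def surplus_def price_0 less_imp_le)
  then show ?thesis by (simp add: indirect_utility_demand_region[OF J(2,1)])
qed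

lemma utility_gain_rises_on_sja_region:
  assumes rival: "ic_mechanism m b r" and x: "x \<in> sja_region m p J" and J: "J \<subseteq> {..<m}" "j \<in> J"
  shows "U x - indirect_utility m b r x \<le> U (x(j := 1)) - indirect_utility m b r (x(j := 1))"
proof -
  interpret rival: ic_mechanism m b r by (rule rival)
  have "x j \<le> 1" using x J by (auto simp: sja_region_def cube_def PiE_iff)
  then have "rival.U (x(j := 1)) \<le> rival.U x + (1 - x j)"
    using rival.indirect_utility_fun_upd_le[of x j 1] by simp
  with indirect_utility_sja_region_fun_upd[OF x J] show ?thesis by simp
qed

lemma utility_gain_nonpos_on_no_sale_region:
  assumes rival: "ic_mechanism m b r" "is_IR m b r" and x: "x \<in> no_sale_region m p"
  shows "U x - indirect_utility m b r x \<le> 0"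
proof -
  interpret rival: ic_mechanism m b r by (rule rival)
  have "0 \<le> rival.U x"
    using rival(2) x by (auto simp: no_sale_region_def is_IR_def rival.indirect_utility_eq)
  with indirect_utility_no_sale_region[OF x] show ?thesis by simp
qed

lemma sja_revenue_maximal:
  assumes m: "1 \<le> m" and prices: "sja_prices m p"
    and free: "\<And>J. J \<subseteq> {..<m} \<Longrightarrow> J \<noteq> {} \<Longrightarrow> sja_region m p J \<noteq> {} \<Longrightarrow>
      deficiency_free 1 (card J) (SIM_body (card J) (sja_lambda m p))"
    and rival: "ic_mechanism m b r" "is_IR m b r"
    and r: "r \<in> borel_measurable (completion (unifM m))"
  shows "revenue m r \<le> revenue m pay"
proof -
  interpret rival: ic_mechanism m b r by (rule rival)
  interpret prices: deficiency_free_prices m "real m + 1" "norm_prices m p" "sja_lambda m p"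
    using free sja_lambda_eq[where p = p, OF price_0]
    by unfold_locales (simp_all add: norm_prices_def price_0 sja_region_eq_demand_region)
  define w where "w x = U x - rival.U x" for x
  have "0 \<le> revenue_functional m w"
    unfolding revenue_functional_def diff_ge_0_iff_ge
  proof (rule prices.integral_le_sum_faces)
    show "continuous_on UNIV w"
      unfolding w_def
      by (intro continuous_intros continuous_on_indirect_utility
          rival.continuous_on_indirect_utility)
    show "prices.rises_with_demand w"
      unfolding prices.rises_with_demand_def w_def
      using utility_gain_rises_on_sja_region[OF rival(1)]
      by (auto simp: sja_region_eq_demand_region)
    show "w x \<le> 0" if "x \<in> no_sale_region m (norm_prices m p)" for x
      unfolding w_def using that
      by (intro utility_gain_nonpos_on_no_sale_region rival) (simp add: no_sale_region_norm_prices)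
    show "measure (cubeM {..<m}) (no_sale_region m (norm_prices m p)) = 1 - real m / (real m + 1)"
      by (simp add: no_sale_region_norm_prices measure_no_sale_region[OF m prices])
  qed
  then have "revenue_functional m rival.U \<le> revenue_functional m U"
    unfolding w_def
    by (simp add: revenue_functional_diff continuous_on_indirect_utility
        rival.continuous_on_indirect_utility)
  then show ?thesis
    by (simp add: revenue_eq_revenue_functional borel_measurable_payment
        rival.revenue_eq_revenue_functional r)
qed

end

theorem theorem4:
  fixes m :: nat and p :: "nat \<Rightarrow> real"
    and a :: "(nat \<Rightarrow> real) \<Rightarrow> (nat \<Rightarrow> real)" and pay :: "(nat \<Rightarrow> real) \<Rightarrow> real"
  assumes "m \<ge> 1"
    and "sja_prices m p"
    and "\<forall>J. J \<subseteq> {..<m} \<and> J \<noteq> {} \<and> sja_region m p J \<noteq> {} \<longrightarrow>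
           \<not> (\<exists>A. body (card J) A \<and> A \<subseteq> SIM_body (card J) (sja_lambda m p)
                  \<and> deficiency 1 (card J) A > 0)"
    and "sja_implements m p a pay"
  shows "revenue m pay = opt_revenue m"
proof -
  interpret sja_mechanism m p a pay
    using assms(2,4) by unfold_locales (simp_all add: sja_prices_def)
  have free: "deficiency_free 1 (card J) (SIM_body (card J) (sja_lambda m p))"
    if "J \<subseteq> {..<m}" "J \<noteq> {}" "sja_region m p J \<noteq> {}" for J
    using assms(3) that unfolding deficiency_free_def by (meson not_less)
  show ?thesis
    unfolding opt_revenue_def
  proof (rule cSup_eq_maximum[symmetric])
    show "revenue m pay \<in> {revenue m p | a p. is_alloc m a \<and> is_IC m a p \<and> is_IR m a p
       \<and> p \<in> borel_measurable (completion (unifM m))}"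
      using sja_is_alloc sja_is_IC sja_is_IR borel_measurable_payment by blast
    show "r \<le> revenue m pay" if "r \<in> {revenue m p | a p. is_alloc m a \<and> is_IC m a p \<and> is_IR m a p
       \<and> p \<in> borel_measurable (completion (unifM m))}" for r
      using that sja_revenue_maximal[OF assms(1,2) free] ic_mechanism.intro by blast
  qed
qed

end
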